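(* Let $d<-3$ be a square-free integer such that the quadratic number field $\mathbb{Q}(\sqrt{d})$ has class number $1$, and let $\mathbb{Z}[\omega]$ be its ring of integers. If $p$ is a rational prime such that $\left(\frac{d}{p}\right) = -1$ (equivalently, $p$ is inert in $\mathbb{Z}[\omega]$), then $\bar{D}(\mathbb{Z}[p\omega]) = p+1$.
   Context: Here $\omega = \sqrt{d}$ if $d\equiv 2,3 \pmod 4$ and $\omega = \frac{1+\sqrt{d}}{2}$ if $d\equiv 1\pmod 4$, so $\mathbb{Z}[\omega]$ is the ring of integers of $\mathbb{Q}(\sqrt d)$, and $\mathbb{Z}[p\omega]$ is the order $\mathbb{Z}+p\omega\mathbb{Z}$. The condition $\left(\frac{d}{p}\right)=-1$ is to be read as: $p$ is inert in $\mathbb{Z}[\omega]$, i.e. $p\mathbb{Z}[\omega]$ is a prime ideal. For an atomic domain $R$ and a non-empty subset $\mathcal{O}\subseteq R$: an $R$-product of length $n$ is a formal product (finite sequence, repetitions allowed) $\pi_1\pi_2\cdots\pi_n$ of irreducible elements $\pi_i\in \mathrm{Irr}(R)$; it is an $\mathcal{O}$-product if its value lies in $\mathcal{O}$. An $\mathcal{O}$-subproduct of an $R$-product is a non-empty subproduct (over a non-empty subset of the indices, possibly all of them) which is an $\mathcal{O}$-product. Define $D_{\mathcal{O}}(R) = \min\{n \mid \text{any } R\text{-product of length } n \text{ has an } \mathcal{O}\text{-subproduct}\}$, and $D_{\mathcal{O}}(R)=\infty$ if no such $n$ exists. If $\mathcal{O}$ is a domain and $R$ is its integral closure, write $\bar{D}(\mathcal{O})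 = D_{\mathcal{O}}(R)$; thus $\bar{D}(\mathbb{Z}[p\omega]) = D_{\mathbb{Z}[p\omega]}(\mathbb{Z}[\omega])$. *)

theory Defs
  imports
    "HOL-Algebra.Algebra"
    "HOL-Algebra.Algebraic_Closure_Type"
    "HOL-Library.Extended_Nat"
    "HOL-Computational_Algebra.Computational_Algebra"
    Complex_Main
begin

text \<open>Subrings of a commutative ring type are viewed as HOL-Algebra rings by restricting the
  carrier; this is meaningful only if the set is closed under the ring operations.\<close>

definition ring_on :: "'a::comm_ring_1 set \<Rightarrow> 'a ring" where
  "ring_on S = ring_of_type_algebra \<lparr>carrier := S\<rparr>"

subsection \<open>The constants $D_S(R)$ and $\bar{D}(S)$\<close>

definition R_product :: "('a, 'b) ring_scheme \<Rightarrow> 'a list \<Rightarrow> bool" where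
  "R_product R xs \<longleftrightarrow> (\<forall>x \<in> set xs. x \<in> carrier R \<and> ring_irreducible\<^bsub>R\<^esub> x)"

definition has_subproduct_in :: "('a, 'b) ring_scheme \<Rightarrow> 'a set \<Rightarrow> 'a list \<Rightarrow> bool" where
  "has_subproduct_in R S xs \<longleftrightarrow>
     (\<exists>I \<subseteq> {..<length xs}. I \<noteq> {} \<and> (\<Otimes>\<^bsub>R\<^esub>i\<in>I. xs ! i) \<in> S)"

text \<open>Formal products of irreducibles are lists; subproducts are given by sets of positions.
  The infimum of the empty set in \<^typ>\<open>enat\<close> is \<open>\<infinity>\<close>.\<close>

definition D_const :: "('a, 'b) ring_scheme \<Rightarrow> 'a set \<Rightarrow> enat" where
  "D_const R S =
     Inf (enat ` {n. \<forall>xs. length xs = n \<and> R_product R xs \<longrightarrow> has_subproduct_in R S xs})"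

definition fraction_field :: "'a::field set \<Rightarrow> 'a set" where
  "fraction_field S = {x / y | x y. x \<in> S \<and> y \<in> S \<and> y \<noteq> 0}"

definition integral_closure :: "'a::field set \<Rightarrow> 'a set" where
  "integral_closure S = {x \<in> fraction_field S.
     \<exists>f. lead_coeff f = 1 \<and> (\<forall>i. coeff f i \<in> S) \<and> poly f x = 0}"

definition D_bar :: "'a::field set \<Rightarrow> enat" where
  "D_bar S = D_const (ring_on (integral_closure S)) S"

subsection \<open>Class number\<close>

definition ring_of_integers :: "complex set \<Rightarrow> complex set" where
  "ring_of_integers K = {x \<in> K. algebraic_int x}"

definition nonzero_ideals :: "('a, 'b) ring_scheme \<Rightarrow> 'a set set" where
  "nonzero_ideals R = {I. ideal I R \<and> I \<noteq> {\<zero>\<^bsub>R\<^esub>}}"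

definition ideal_class_rel :: "('a, 'b) ring_scheme \<Rightarrow> ('a set \<times> 'a set) set" where
  "ideal_class_rel R = {(I, J). I \<in> nonzero_ideals R \<and> J \<in> nonzero_ideals R \<and>
     (\<exists>a \<in> carrier R - {\<zero>\<^bsub>R\<^esub>}. \<exists>b \<in> carrier R - {\<zero>\<^bsub>R\<^esub>}. a <#\<^bsub>R\<^esub> I = b <#\<^bsub>R\<^esub> J)}"

text \<open>Since \<^const>\<open>card\<close> is \<open>0\<close> on infinite sets, class number \<open>1\<close> means exactly one ideal class.\<close>

definition class_number :: "complex set \<Rightarrow> nat" where
  "class_number K =
     (let R = ring_on (ring_of_integers K) in card (nonzero_ideals R // ideal_class_rel R))"

subsection \<open>Quadratic fields and orders\<close>

definition quad_field :: "int \<Rightarrow> complex set" where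
  "quad_field d = {of_rat a + of_rat b * csqrt (of_int d) | a b. True}"

definition omega :: "int \<Rightarrow> complex" where
  "omega d = (if d mod 4 = 1 then (1 + csqrt (of_int d)) / 2 else csqrt (of_int d))"

text \<open>The group \<open>\<int> + \<int>\<alpha>\<close>, which is the ring \<open>\<int>[\<alpha>]\<close> whenever \<open>\<alpha>\<close> is a quadratic integer.\<close>

definition quad_order :: "complex \<Rightarrow> complex set" where
  "quad_order \<alpha> = {of_int a + of_int b * \<alpha> | a b. True}"

definition inert :: "nat \<Rightarrow> int \<Rightarrow> bool" where
  "inert p d \<longleftrightarrow>
     (let R = ring_on (quad_order (omega d)) in primeideal (PIdl\<^bsub>R\<^esub> (of_nat p)) R)"

end

theory Submission
  imports
    Defs
    "HOL-Analysis.Analysis"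
    "HOL-Number_Theory.Residues"
begin

text \<open>Write \<open>R = \<int>[\<omega>]\<close>. Since \<open>p\<close> is inert, \<open>R/pR\<close> is the field with \<open>p\<^sup>2\<close> elements, and an
  element prime to \<open>p\<close> lies in \<open>\<int>[p\<omega>]\<close> iff its image in the cyclic group
  \<open>(R/pR)\<^sup>* / (\<int>/p)\<^sup>*\<close> of order \<open>n = p + 1\<close> is trivial. The upper bound is the pigeonhole principle for
  the partial products. For the lower bound it suffices to repeat \<open>p\<close> times an irreducible element whose
  class generates the group.

  Such an element is found by an analytic argument. As \<open>R\<close> is a principal ideal domain with units \<open>\<plusminus>1\<close>, the
  characters \<open>\<psi>\<^sub>j\<close> of the cyclic group give L-series \<open>L\<^sub>j(s) = \<Sum> \<psi>\<^sub>j(x) |x|\<^sup>-\<^sup>s\<close> with Euler products.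
  They are bounded on \<open>2 < s \<le> 3\<close> for \<open>j \<noteq> 0\<close>, while \<open>L\<^sub>0(s)\<close> is unbounded as \<open>s\<close> tends to \<open>2\<close>.
  Take weights \<open>a\<^sub>j\<close> with \<open>a\<^sub>0 > 0\<close> and \<open>a\<^sub>j \<le> 0\<close> for \<open>j \<noteq> 0\<close> such that \<open>\<Sum>\<^sub>j a\<^sub>j \<psi>\<^sub>j\<close> is positive only at
  the classes \<open>\<plusminus>1\<close>. If no irreducible element had class \<open>\<plusminus>1\<close>, then \<open>\<Sum>\<^sub>j a\<^sub>j ln |L\<^sub>j(s)|\<close> would be bounded
  above, and hence so would be \<open>L\<^sub>0(s)\<close>. Because of the signs of the weights, non-vanishing of the \<open>L\<^sub>j\<close> at
  the edge \<open>s = 2\<close> is never needed.\<close>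

subsection \<open>Rings of imaginary quadratic integers\<close>

lemma summable_on_int_powr:
  assumes "s > (1::real)"
  shows "(\<lambda>n::int. (1 + real_of_int \<bar>n\<bar>) powr (- s)) summable_on UNIV"
proof -
  have "summable (\<lambda>n. (real (Suc n)) powr (- s))"
    using assms summable_real_powr_iff[of "-s"] summable_Suc_iff[of "\<lambda>n. real n powr (- s)"] by simp
  hence nat: "(\<lambda>n. (1 + real n) powr (- s)) summable_on UNIV"
    by (intro norm_summable_imp_summable_on) (simp add: add.commute)
  have 1: "(\<lambda>n::int. (1 + real_of_int \<bar>n\<bar>) powr (- s)) summable_on (range int)"
    using nat by (subst summable_on_reindex) (auto simp: o_def)
  have 2: "(\<lambda>n::int. (1 + real_of_int \<bar>n\<bar>) powr (- s)) summable_on (range (\<lambda>n. - int n))"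
    using nat by (subst summable_on_reindex) (auto simp: o_def inj_on_def)
  have "(UNIV::int set) = range int \<union> range (\<lambda>n. - int n)"
    by (auto simp: image_iff) (metis int_cases2 )
  with summable_on_union[OF 1 2] show ?thesis by simp
qed

lemma sum_inverse_unbounded: "\<exists>M. (\<Sum>a=1..M. 1 / real a) > K"
proof -
  have "filterlim (harm :: nat \<Rightarrow> real) at_top sequentially" by (rule harm_at_top)
  hence "eventually (\<lambda>n. harm n > K) sequentially" 
    using filterlim_at_top_dense by blast
  then obtain M where "harm M > K" by (auto simp: eventually_sequentially)
  thus ?thesis by (auto simp: harm_def inverse_eq_divide)
qed

text \<open>The generator \<open>w\<close> is a non-real root of X^2 - t X + m, so \<open>t\<close>
  is its trace and \<open>m\<close> its norm. This covers both shapes of \<open>omega d\<close> at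
  once; \<open>Im_pos\<close> makes 1 and \<open>w\<close> linearly independent over the
  rationals.\<close>

locale imag_quad =
  fixes w :: complex and t m :: int
  assumes Im_pos: "Im w > 0"
    and w_sq: "w * w = of_int t * w - of_int m"
begin

abbreviation R :: "complex set" where "R \<equiv> quad_order w"

lemma R_I [intro]: "of_int a + of_int b * w \<in> R" by (auto simp: quad_order_def)

lemma R_E: assumes "x \<in> R" obtains a b where "x = of_int a + of_int b * w"
  using assms by (auto simp: quad_order_def)

lemma R_int [simp, intro]: "of_int a \<in> R" using R_I[of a 0] by simp
lemma R_nat [simp, intro]: "of_nat a \<in> R" using R_int[of "int a"] by simp
lemma R_0 [simp, intro]: "0 \<in> R" using R_int[of 0] by simp
lemma R_1 [simp, intro]: "1 \<in> R" using R_int[of 1] by simp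
lemma R_w [simp, intro]: "w \<in> R" using R_I[of 0 1] by simp

lemma R_add [intro]: assumes "x \<in> R" "y \<in> R" shows "x + y \<in> R"
proof -
  from assms obtain a b c d where "x = of_int a + of_int b * w" "y = of_int c + of_int d * w"
    by (elim R_E)
  hence "x + y = of_int (a + c) + of_int (b + d) * w" by (simp add: algebra_simps)
  thus ?thesis by (metis R_I)
qed

lemma R_minus [intro]: assumes "x \<in> R" shows "- x \<in> R"
proof -
  from assms obtain a b where "x = of_int a + of_int b * w" by (elim R_E)
  hence "- x = of_int (- a) + of_int (- b) * w" by simp
  thus ?thesis by (metis R_I)
qed

lemma R_diff [intro]: assumes "x \<in> R" "y \<in> R" shows "x - y \<in> R"
  using R_add[of x "- y"] R_minus[of y] assms by simp

lemma R_mult [intro]: assumes "x \<in> R" "y \<in> R" shows "x * y \<in> R"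
proof -
  from assms obtain a b c d where "x = of_int a + of_int b * w" "y = of_int c + of_int d * w"
    by (elim R_E)
  hence "x * y = of_int (a * c) + of_int (a * d + b * c) * w + of_int (b * d) * (w * w)"
    by (simp add: algebra_simps)
  also have "\<dots> = of_int (a * c - b * d * m) + of_int (a * d + b * c + b * d * t) * w"
    by (simp add: w_sq algebra_simps)
  finally show ?thesis by (metis R_I)
qed

lemma R_power [intro]: "x \<in> R \<Longrightarrow> x ^ n \<in> R"
  by (induction n) auto

lemma R_prod [intro]: "(\<And>i. i \<in> I \<Longrightarrow> f i \<in> R) \<Longrightarrow> prod f I \<in> R"
  by (induction I rule: infinite_finite_induct) auto

lemma R_sum [intro]: "(\<And>i. i \<in> I \<Longrightarrow> f i \<in> R) \<Longrightarrow> sum f I \<in> R"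
  by (induction I rule: infinite_finite_induct) auto

lemma pair_eq_iff: "of_int a + of_int b * w = of_int c + of_int d * w \<longleftrightarrow> a = c \<and> b = d"
proof
  assume *: "of_int a + of_int b * w = of_int c + of_int d * w"
  hence "Im (of_int a + of_int b * w) = Im (of_int c + of_int d * w)" by simp
  hence "b = d" using Im_pos by simp
  with * show "a = c \<and> b = d" by simp
qed auto

lemma int_mult_dvd:
  "(\<exists>z\<in>R. of_int a + of_int b * w = of_int k * z) \<longleftrightarrow> k dvd a \<and> k dvd b"
proof
  assume "\<exists>z\<in>R. of_int a + of_int b * w = of_int k * z"
  then obtain c d where "of_int a + of_int b * w = of_int k * (of_int c + of_int d * w)"
    by (auto elim!: R_E)
  also have "\<dots> = of_int (k * c) + of_int (k * d) * w" by (simp add: algebra_simps)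
  finally show "k dvd a \<and> k dvd b" by (simp only: pair_eq_iff) auto
next
  assume "k dvd a \<and> k dvd b"
  then obtain c d where "a = k * c" "b = k * d" by (auto elim!: dvdE)
  hence "of_int a + of_int b * w = of_int k * (of_int c + of_int d * w)" by (simp add: algebra_simps)
  thus "\<exists>z\<in>R. of_int a + of_int b * w = of_int k * z" by blast
qed

lemma trace_w: "real_of_int t = 2 * Re w" and norm_w: "real_of_int m = (cmod w)\<^sup>2"
proof -
  have "Im (w * w) = Im (of_int t * w - of_int m)" "Re (w * w) = Re (of_int t * w - of_int m)"
    by (simp_all add: w_sq)
  hence *: "2 * Re w * Im w = t * Im w" "Re w * Re w - Im w * Im w = t * Re w - m" by simp_all
  thus 1: "real_of_int t = 2 * Re w" using Im_pos by simp
  show "real_of_int m = (cmod w)\<^sup>2" using *(2) unfolding 1 cmod_power2 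
    by (simp add: power2_eq_square algebra_simps)
qed

lemma norm_pair: "(cmod (of_int a + of_int b * w))\<^sup>2 = real_of_int (a\<^sup>2 + t * a * b + m * b\<^sup>2)"
  by (simp add: cmod_power2 trace_w norm_w) (simp add: power2_eq_square algebra_simps)

lemma norm_sq_int: assumes "x \<in> R" obtains N :: nat where "(cmod x)\<^sup>2 = real N"
proof -
  from assms obtain a b where x: "x = of_int a + of_int b * w" by (elim R_E)
  have "(cmod x)\<^sup>2 = real_of_int (a\<^sup>2 + t * a * b + m * b\<^sup>2)" unfolding x by (rule norm_pair)
  moreover from this have "0 \<le> a\<^sup>2 + t * a * b + m * b\<^sup>2" by (smt (verit) of_int_0_le_iff zero_le_power2)
  ultimately show ?thesis using that[of "nat (a\<^sup>2 + t * a * b + m * b\<^sup>2)"] by simp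
qed

lemma norm_ge_1: assumes "x \<in> R" "x \<noteq> 0" shows "cmod x \<ge> 1"
proof -
  obtain N :: nat where N: "(cmod x)\<^sup>2 = real N" using norm_sq_int assms(1) by blast
  have "(cmod x)\<^sup>2 > 0" using assms(2) by simp
  hence "N > 0" unfolding N by simp
  hence "1\<^sup>2 \<le> (cmod x)\<^sup>2" using N by simp
  thus ?thesis by (rule power2_le_imp_le) simp
qed

lemma conj_mem: assumes "x \<in> R" shows "cnj x \<in> R"
proof -
  have "cnj w = of_int t - w" by (simp add: complex_eq_iff trace_w)
  moreover from assms obtain a b where "x = of_int a + of_int b * w" by (elim R_E)
  ultimately have "cnj x = of_int a + of_int b * (of_int t - w)" by simp
  thus ?thesis by (auto intro!: R_add R_diff R_mult)
qed

text \<open>Each coordinate, and also the constant 1, is at most a fixed multiple of |x|. The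
  product on the left splits the later lattice sum into two one-dimensional sums of exponent
  s/2.\<close>

lemma coord_bound:
  obtains K where "K \<ge> 1" "\<And>a b. (1 + real_of_int \<bar>a\<bar>) * (1 + real_of_int \<bar>b\<bar>) \<le> 4 * (K * cmod (of_int a + of_int b * w))\<^sup>2 
     \<or> (a = 0 \<and> b = 0)"
proof -
  define v where "v = inverse (Im w)"
  have v: "v > 0" using Im_pos by (simp add: v_def)
  \<comment> \<open>\<open>v\<close> controls b through the imaginary part,
    \<open>1 + cmod w * v\<close> then controls a by the triangle inequality; their sum is a common
    constant that is at least 1.\<close>
  define K where "K = 1 + v + cmod w * v"
  have Kv: "K \<ge> v" and K: "K \<ge> 1" using v by (simp_all add: K_def)
  show ?thesis
  proof (rule that[OF K])
    fix a b :: int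
    define x where "x = of_int a + of_int b * w"
    show "(1 + real_of_int \<bar>a\<bar>) * (1 + real_of_int \<bar>b\<bar>) \<le> 4 * (K * cmod (of_int a + of_int b * w))\<^sup>2 \<or> (a = 0 \<and> b = 0)"
    proof (cases "a = 0 \<and> b = 0")
      case False
      hence "x \<noteq> 0" using pair_eq_iff[of a b 0 0] by (simp add: x_def)
      hence x1: "cmod x \<ge> 1" using norm_ge_1[of x] by (auto simp: x_def)
      have "Im x = b * Im w" by (simp add: x_def)
      hence "\<bar>real_of_int b\<bar> * Im w \<le> cmod x" using abs_Im_le_cmod[of x] Im_pos by (simp add: abs_mult)
      hence b: "\<bar>real_of_int b\<bar> \<le> v * cmod x" using Im_pos by (simp add: v_def field_simps)
      also have "\<dots> \<le> K * cmod x" by (intro mult_right_mono Kv) auto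
      finally have b': "\<bar>real_of_int b\<bar> \<le> K * cmod x" .
      have "of_int a = x - of_int b * w" by (simp add: x_def)
      hence "cmod (of_int a) \<le> cmod x + cmod (of_int b * w)" by (simp only: norm_triangle_ineq4)
      hence "\<bar>real_of_int a\<bar> \<le> cmod x + \<bar>real_of_int b\<bar> * cmod w" by (simp add: norm_mult)
      also have "\<dots> \<le> cmod x + (v * cmod x) * cmod w" using b by (intro add_left_mono mult_right_mono) auto
      also have "\<dots> \<le> cmod x + (v * cmod x) * cmod w + v * cmod x" using v by simp
      also have "\<dots> = K * cmod x" by (simp add: K_def algebra_simps)
      finally have a': "\<bar>real_of_int a\<bar> \<le> K * cmod x" .
      have "1 \<le> K * cmod x" using K x1 using mult_mono[of 1 K 1 "cmod x"] by simp
      hence "(1 + real_of_int \<bar>a\<bar>) * (1 + real_of_int \<bar>b\<bar>) \<le> (2 * (K * cmod x)) * (2 * (K * cmod x))"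
        using a' b' by (intro mult_mono) auto
      thus ?thesis by (simp add: x_def power2_eq_square algebra_simps)
    qed auto
  qed
qed

text \<open>Here and below the term at \<open>0\<close> vanishes because \<open>0 powr s = 0\<close>.\<close>

lemma summable_norm_powr:
  assumes "s > 2"
  shows "(\<lambda>x. cmod x powr (- s)) summable_on R"
proof -
  obtain K where K: "K \<ge> 1" and K': "\<And>a b. (1 + real_of_int \<bar>a\<bar>) * (1 + real_of_int \<bar>b\<bar>) \<le> 4 * (K * cmod (of_int a + of_int b * w))\<^sup>2 
     \<or> (a = 0 \<and> b = 0)" by (rule coord_bound) blast
  define pt where "pt = (\<lambda>(a,b). of_int a + of_int b * w)"
  have inj: "inj pt" by (auto simp: inj_on_def pt_def pair_eq_iff)
  have R: "R = range pt" by (auto simp: pt_def quad_order_def)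
  define h where "h = (\<lambda>n::int. (1 + real_of_int \<bar>n\<bar>) powr (- (s/2)))"
  have h: "h summable_on UNIV" unfolding h_def by (rule summable_on_int_powr) (use assms in auto)
  have "(\<lambda>(a,b). h a * h b) summable_on UNIV \<times> UNIV"
  proof (rule summable_on_SigmaI[where g = "\<lambda>a. h a * infsum h UNIV"])
    show "((\<lambda>b. (\<lambda>(a,b). h a * h b) (a, b)) has_sum h a * infsum h UNIV) UNIV" for a
      using has_sum_cmult_right[OF has_sum_infsum[OF h], of "h a"] by simp
    show "(\<lambda>a. h a * infsum h UNIV) summable_on UNIV" by (rule summable_on_cmult_left[OF h])
    show "(\<lambda>(a,b). h a * h b) (a, b) \<ge> 0" for a b by (simp add: h_def)
  qed
  hence "(\<lambda>z. (4 * K\<^sup>2) powr (s/2) * (\<lambda>(a,b). h a * h b) z) summable_on UNIV"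
    by (intro summable_on_cmult_right) simp
  hence "(\<lambda>z. cmod (pt z) powr (- s)) summable_on UNIV"
  proof (rule summable_on_comparison_test)
    fix z :: "int \<times> int"
    obtain a b where z: "z = (a,b)" by (cases z)
    show "cmod (pt z) powr - s \<le> (4 * K\<^sup>2) powr (s / 2) * (case z of (a, b) \<Rightarrow> h a * h b)"
    proof (cases "a = 0 \<and> b = 0")
      case True
      thus ?thesis by (auto simp: z pt_def h_def)
    next
      case False
      define x where "x = pt z"
      have "x \<noteq> 0" using False pair_eq_iff[of a b 0 0] by (auto simp: x_def pt_def z)
      have "((1 + real_of_int \<bar>a\<bar>) * (1 + real_of_int \<bar>b\<bar>)) powr (s/2) \<le> ((4 * K\<^sup>2) * (cmod x)\<^sup>2) powr (s/2)"
        using K'[of a b] False assms by (intro powr_mono2) (auto simp: x_def z pt_def power_mult_distrib algebra_simps)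
      also have "\<dots> = (4 * K\<^sup>2) powr (s/2) * ((cmod x)\<^sup>2) powr (s/2)" using K by (subst powr_mult) auto
      also have "((cmod x)\<^sup>2) powr (s/2) = cmod x powr s" 
        using \<open>x \<noteq> 0\<close> by (simp add: powr_powr flip: powr_numeral)
      finally have "((1 + real_of_int \<bar>a\<bar>) powr (s/2) * (1 + real_of_int \<bar>b\<bar>) powr (s/2)) \<le> (4 * K\<^sup>2) powr (s/2) * cmod x powr s"
        by (subst (asm) powr_mult) auto
      thus ?thesis using \<open>x \<noteq> 0\<close>
        by (simp add: z h_def powr_minus x_def[symmetric, unfolded z] field_simps)
    qed
  qed auto
  thus ?thesis unfolding R using inj by (subst summable_on_reindex) (auto simp: o_def)
qed


text \<open>The triangle of lattice points 1 \<le> b \<le> a \<le> M, scaled by p and shifted by 1,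
  has a points in row a, each of absolute value at most C a. Row a thus contributes at least 1 /
  (C^2 a), and the harmonic series diverges. For p \<ge> 2, being 1 modulo p keeps the points prime
  to p, so that the trivial character is 1 there.\<close>

lemma norm_sq_sum_unbounded:
  fixes p :: nat and B :: real
  assumes "p > 0"
  shows "\<exists>F. finite F \<and> F \<subseteq> {x \<in> R. x \<noteq> 0 \<and> (\<exists>y\<in>R. x = of_nat p * y + 1)} \<and> (\<Sum>x\<in>F. cmod x powr (- 2)) > B"
proof -
  define C where "C = p * (1 + cmod w) + 1"
  have C: "C \<ge> 1" by (auto simp: C_def)
  obtain M where M: "(\<Sum>a=1..M. 1 / real a) > C\<^sup>2 * B" using sum_inverse_unbounded by blast
  define I where "I = (SIGMA a:{1..M}. {1..a})"
  define q where "q = (\<lambda>(a,b). of_nat p * (of_nat a + of_nat b * w) + (1::complex))"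
  have inj: "inj_on q I"
  proof (rule inj_onI, clarsimp)
    fix a b c d assume "q (a, b) = q (c, d)"
    hence "of_int (int a) + of_int (int b) * w = of_int (int c) + of_int (int d) * w" 
      using assms by (simp add: q_def)
    thus "a = c \<and> b = d" by (simp only: pair_eq_iff) simp
  qed
  have sub: "q ` I \<subseteq> {x \<in> R. x \<noteq> 0 \<and> (\<exists>y\<in>R. x = of_nat p * y + 1)}"
  proof clarify
    fix a b assume ab: "(a, b) \<in> I"
    have y: "of_nat a + of_nat b * w \<in> R" by auto
    moreover have "Im (q (a, b)) = real (p * b) * Im w" by (simp add: q_def)
    hence "Im (q (a,b)) > 0" using ab assms Im_pos by (auto simp: I_def)
    hence "q (a,b) \<noteq> 0" by auto
    moreover have "q (a,b) = of_nat p * (of_nat a + of_nat b * w) + 1" by (simp add: q_def)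
    moreover from this y have "q (a,b) \<in> R" by (auto intro!: R_add R_mult)
    ultimately show "q (a,b) \<in> R \<and> q (a,b) \<noteq> 0 \<and> (\<exists>y\<in>R. q (a,b) = of_nat p * y + 1)" by blast
  qed
  have "(\<Sum>x\<in>q ` I. cmod x powr (- 2)) = (\<Sum>(a,b)\<in>I. cmod (q (a,b)) powr (- 2))"
    by (subst sum.reindex[OF inj]) (auto simp: o_def intro!: sum.cong)
  also have "\<dots> = (\<Sum>a=1..M. \<Sum>b=1..a. cmod (q (a,b)) powr (- 2))"
    unfolding I_def by (subst sum.Sigma) auto
  also have "\<dots> \<ge> (\<Sum>a=1..M. \<Sum>b=1..a. (C * a) powr (- 2))"
  proof (intro sum_mono)
    fix a b assume a: "a \<in> {1..M}" and b: "b \<in> {1..a}"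
    have "q (a,b) \<in> q ` I" using a b by (intro imageI) (simp add: I_def)
    hence "q (a,b) \<noteq> 0" using sub by blast
    have "cmod (of_nat a + of_nat b * w) \<le> a + b * cmod w"
      by (metis norm_mult norm_of_nat norm_triangle_ineq)
    also have "\<dots> \<le> a * (1 + cmod w)" using b by (simp add: algebra_simps mult_right_mono)
    finally have "cmod (of_nat p * (of_nat a + of_nat b * w)) \<le> p * (a * (1 + cmod w))"
      by (simp add: norm_mult mult_left_mono)
    hence "cmod (q (a,b)) \<le> p * (a * (1 + cmod w)) + 1"
      by (simp add: q_def) (smt (verit) norm_one norm_triangle_ineq)
    also have "\<dots> \<le> C * a" using a by (simp add: C_def algebra_simps)
    finally show "(C * a) powr (- 2) \<le> cmod (q (a,b)) powr (- 2)"
      using \<open>q (a,b) \<noteq> 0\<close> by (intro powr_mono2') auto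
  qed
  also have "(\<Sum>a=1..M. \<Sum>b=1..a. (C * a) powr (- 2)) = (\<Sum>a=1..M. (1 / C\<^sup>2) * (1 / real a))"
  proof (intro sum.cong refl)
    fix a assume "a \<in> {1..M}"
    hence "(C * a) powr (- 2) = 1 / (C * a)\<^sup>2" using C by (simp add: powr_minus_divide)
    with \<open>a \<in> {1..M}\<close> C show "(\<Sum>b=1..a. (C * real a) powr - 2) = 1 / C\<^sup>2 * (1 / real a)"
      by (simp add: power2_eq_square field_simps)
  qed
  also have "\<dots> = (1 / C\<^sup>2) * (\<Sum>a=1..M. 1 / real a)" by (rule sum_distrib_left[symmetric])
  finally have "(\<Sum>x\<in>q ` I. cmod x powr (- 2)) \<ge> (1 / C\<^sup>2) * (\<Sum>a=1..M. 1 / real a)" by simp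
  moreover have "(1 / C\<^sup>2) * (\<Sum>a=1..M. 1 / real a) > B" using M C by (simp add: field_simps)
  ultimately have "(\<Sum>x\<in>q ` I. cmod x powr (- 2)) > B" by linarith
  moreover have "finite (q ` I)" by (auto simp: I_def)
  ultimately show ?thesis using sub by blast
qed

end

subsection \<open>Character sums and the Euler product\<close>

lemma has_sum_finite_sum:
  fixes f :: "'b \<Rightarrow> 'a \<Rightarrow> 'c::topological_comm_monoid_add"
  assumes "\<And>r. r \<in> T \<Longrightarrow> (f r has_sum S r) A"
  shows "((\<lambda>x. \<Sum>r\<in>T. f r x) has_sum (\<Sum>r\<in>T. S r)) A"
  using assms by (induction T rule: infinite_finite_induct) (auto intro!: has_sum_add)

text \<open>By the mean value theorem the difference is |u - v| s z^(-s-1) for an intermediate z,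
  and z^(-s-1) \<le> z^(-3) since s \<ge> 2 and z \<ge> 1. Adding the values at both ends makes the
  bound symmetric; it is uniform in s.\<close>

lemma powr_diff_bound:
  fixes u v s :: real
  assumes "1 \<le> u" "1 \<le> v" "2 \<le> s" "s \<le> 3"
  shows "\<bar>u powr (- s) - v powr (- s)\<bar> \<le> 3 * \<bar>u - v\<bar> * (u powr (- 3) + v powr (- 3))"
proof -
  have *: "\<bar>a powr (- s) - b powr (- s)\<bar> \<le> 3 * \<bar>a - b\<bar> * a powr (- 3)" if ab: "1 \<le> a" "a < b" for a b
  proof -
    have "\<exists>z>a. z < b \<and> b powr (- s) - a powr (- s) = (b - a) * (- s * z powr (- s - 1))"
      using ab by (intro MVT2) (auto intro!: derivative_eq_intros)
    then obtain z where z: "a < z" "z < b" and eq: "b powr (- s) - a powr (- s) = (b - a) * (- s * z powr (- s - 1))"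
      by blast
    have "z powr (- s - 1) \<le> z powr (- 3)" using z ab assms by (intro powr_mono) auto
    also have "\<dots> \<le> a powr (- 3)" using z ab by (intro powr_mono2') auto
    finally have "s * z powr (- s - 1) \<le> 3 * a powr (- 3)" using assms by (intro mult_mono) auto
    hence le: "(b - a) * (s * z powr (- s - 1)) \<le> (b - a) * (3 * a powr (- 3))"
      using ab by (intro mult_left_mono) auto
    have "\<bar>a powr (- s) - b powr (- s)\<bar> = (b - a) * (s * z powr (- s - 1))"
      unfolding abs_minus_commute[of "a powr _"] eq using ab assms by (simp add: abs_mult)
    also note le
    also have "(b - a) * (3 * a powr (- 3)) = 3 * \<bar>a - b\<bar> * a powr (- 3)" using ab by simp
    finally show ?thesis .
  qed
  consider "u < v" | "v < u" | "u = v" by linarith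
  thus ?thesis
  proof cases
    case 1
    have "3 * \<bar>u - v\<bar> * u powr (- 3) \<le> 3 * \<bar>u - v\<bar> * (u powr (- 3) + v powr (- 3))"
      by (intro mult_left_mono) auto
    with *[of u v] 1 assms show ?thesis by linarith
  next
    case 2
    have "3 * \<bar>u - v\<bar> * v powr (- 3) \<le> 3 * \<bar>u - v\<bar> * (u powr (- 3) + v powr (- 3))"
      by (intro mult_left_mono) auto
    with *[of v u] 2 assms show ?thesis
      unfolding abs_minus_commute[of v u] abs_minus_commute[of "v powr _"] by linarith
  qed simp
qed

context imag_quad
begin

lemma bij_betw_translate: "r \<in> R \<Longrightarrow> bij_betw (\<lambda>x. x + r) R R"
  by (rule bij_betw_byWitness[where f' = "\<lambda>x. x - r"]) auto

text \<open>Averaging the sum over the translates by \<open>T\<close> replaces \<open>|x|\<^sup>-\<^sup>s\<close> by its differences,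
  which are of order \<open>|x|\<^sup>-\<^sup>3\<close>.\<close>

lemma character_sum_bounded:
  fixes \<psi> :: "complex \<Rightarrow> complex"
  assumes T: "finite T" "T \<subseteq> R" "T \<noteq> {}"
    and le1: "\<And>x. x \<in> R \<Longrightarrow> cmod (\<psi> x) \<le> 1"
    and zero: "\<And>x. x \<in> R \<Longrightarrow> (\<Sum>r\<in>T. \<psi> (x + r)) = 0"
  shows "\<exists>C. \<forall>s. 2 < s \<and> s \<le> 3 \<longrightarrow> cmod (\<Sum>\<^sub>\<infinity>x\<in>R. \<psi> x * of_real (cmod x powr (- s))) \<le> C"
proof -
  \<comment> \<open>The extra 1 at the origin pays for the pairs with x = 0 or x + r = 0, where the
    mean value estimate fails.\<close>
  define h where "h = (\<lambda>x::complex. cmod x powr (- 3) + (if x = 0 then 1 else 0))"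
  \<comment> \<open>A bound for every |r| with r in \<open>T\<close>, made at least 1 for the sake
    of the exceptional pairs.\<close>
  define \<rho> where "\<rho> = 1 + (\<Sum>r\<in>T. cmod r)"
  have \<rho>: "\<rho> \<ge> 1" by (auto simp: \<rho>_def sum_nonneg)
  have h0: "h x \<ge> 0" for x by (auto simp: h_def)
  have sh: "h summable_on R"
  proof -
    have "(\<lambda>x::complex. if x = 0 then 1 else 0 :: real) summable_on R"
      by (rule finite_nonzero_values_imp_summable_on) (rule finite_subset[of _ "{0}"], auto)
    thus ?thesis unfolding h_def by (intro summable_on_add summable_norm_powr) auto
  qed
  have sh': "(\<lambda>x. h (x + r)) summable_on R" "(\<Sum>\<^sub>\<infinity>x\<in>R. h (x + r)) = infsum h R" if "r \<in> T" for r
    using summable_on_reindex_bij_betw[OF bij_betw_translate, of r h]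
      infsum_reindex_bij_betw[OF bij_betw_translate, of r h] T that sh by auto
  have "cmod (\<Sum>\<^sub>\<infinity>x\<in>R. \<psi> x * of_real (cmod x powr (- s))) \<le> 6 * \<rho> * infsum h R"
    if s: "2 < s" "s \<le> 3" for s
  proof -
    define g where "g = (\<lambda>x::complex. cmod x powr (- s))"
    define L where "L = (\<Sum>\<^sub>\<infinity>x\<in>R. \<psi> x * of_real (g x))"
    have sg: "g summable_on R" unfolding g_def using s by (intro summable_norm_powr) auto
    have sf: "(\<lambda>x. \<psi> x * of_real (g x)) summable_on R"
    proof (rule abs_summable_summable, rule summable_on_comparison_test[OF sg])
      fix x assume "x \<in> R"
      thus "norm (\<psi> x * of_real (g x)) \<le> g x"
        using mult_right_mono[OF le1[of x], of "g x"] by (simp add: norm_mult g_def)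
    qed auto
    have g_diff: "\<bar>g (x + r) - g x\<bar> \<le> 3 * \<rho> * (h (x + r) + h x)" if "x \<in> R" "r \<in> T" for x r
    proof -
      have g1: "0 \<le> g y" "g y \<le> 1" if "y \<in> R" for y
        using norm_ge_1[OF that] s powr_mono2'[of "-s" 1 "cmod y"] by (cases "y = 0"; simp add: g_def)+
      have xr: "x + r \<in> R" using that T by auto
      show ?thesis
      proof (cases "x = 0 \<or> x + r = 0")
        case True
        hence "1 \<le> h (x + r) + h x" by (auto simp: h_def)
        hence "1 * 1 \<le> (3 * \<rho>) * (h (x + r) + h x)" using \<rho> by (intro mult_mono) auto
        thus ?thesis using g1[of x] g1[of "x + r"] that xr by linarith
      next
        case False
        have "cmod r \<le> (\<Sum>r\<in>T. cmod r)" using that T by (intro member_le_sum) auto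
        hence "\<bar>cmod (x + r) - cmod x\<bar> \<le> \<rho>"
          using norm_triangle_ineq3[of "x + r" x] by (simp add: \<rho>_def)
        hence "3 * \<bar>cmod (x + r) - cmod x\<bar> * (h (x + r) + h x) \<le> 3 * \<rho> * (h (x + r) + h x)"
          using h0[of x] h0[of "x+r"] by (intro mult_right_mono) auto
        moreover have "\<bar>g (x + r) - g x\<bar> \<le> 3 * \<bar>cmod (x + r) - cmod x\<bar> * (h (x + r) + h x)"
          using powr_diff_bound[of "cmod (x + r)" "cmod x" s] norm_ge_1[OF xr] norm_ge_1[OF \<open>x \<in> R\<close>] False s
          by (simp add: g_def h_def)
        ultimately show ?thesis by linarith
      qed
    qed
    have sfr: "(\<lambda>x. \<psi> (x + r) * of_real (g (x + r))) summable_on R" 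
      and Lr: "(\<Sum>\<^sub>\<infinity>x\<in>R. \<psi> (x + r) * of_real (g (x + r))) = L" if "r \<in> T" for r
      using summable_on_reindex_bij_betw[OF bij_betw_translate, of r "\<lambda>x. \<psi> x * of_real (g x)"]
        infsum_reindex_bij_betw[OF bij_betw_translate, of r "\<lambda>x. \<psi> x * of_real (g x)"] T that sf
      by (auto simp: L_def)
    \<comment> \<open>Subtracting \<open>g x\<close> inside changes nothing in total, since the
      values of \<psi> at the translates of x sum to 0. What remains is a difference of
      \<open>g\<close>, dominated independently of s.\<close>
    define D where "D = (\<lambda>x. \<Sum>r\<in>T. \<psi> (x + r) * of_real (g (x + r) - g x))"
    have "of_nat (card T) * L = (\<Sum>r\<in>T. \<Sum>\<^sub>\<infinity>x\<in>R. \<psi> (x + r) * of_real (g (x + r)))"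
      by (simp add: Lr)
    also have "\<dots> = (\<Sum>\<^sub>\<infinity>x\<in>R. \<Sum>r\<in>T. \<psi> (x + r) * of_real (g (x + r)))"
    proof -
      have "((\<lambda>x. \<Sum>r\<in>T. \<psi> (x + r) * of_real (g (x + r))) has_sum 
             (\<Sum>r\<in>T. \<Sum>\<^sub>\<infinity>x\<in>R. \<psi> (x + r) * of_real (g (x + r)))) R"
        by (intro has_sum_finite_sum has_sum_infsum sfr)
      thus ?thesis by (simp add: infsumI)
    qed
    also have "\<dots> = infsum D R"
    proof (rule infsum_cong)
      fix x assume x: "x \<in> R"
      have "D x = (\<Sum>r\<in>T. \<psi> (x + r) * of_real (g (x + r))) - (\<Sum>r\<in>T. \<psi> (x + r)) * of_real (g x)"
        by (simp add: D_def right_diff_distrib sum_subtractf sum_distrib_right)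
      thus "(\<Sum>r\<in>T. \<psi> (x + r) * of_real (g (x + r))) = D x" using zero[OF x] by simp
    qed
    finally have LD: "of_nat (card T) * L = infsum D R" .
    define H where "H = (\<lambda>x. \<Sum>r\<in>T. 3 * \<rho> * (h (x + r) + h x))"
    have H: "(H has_sum (\<Sum>r\<in>T. 3 * \<rho> * (infsum h R + infsum h R))) R"
      unfolding H_def
      by (intro has_sum_finite_sum has_sum_cmult_right has_sum_add) (simp_all add: has_sum_iff sh sh')
    have DH: "cmod (D x) \<le> H x" if x: "x \<in> R" for x
      unfolding D_def H_def
    proof (rule sum_norm_le)
      fix r assume r: "r \<in> T"
      have "x + r \<in> R" using r x T by auto
      hence "cmod (\<psi> (x + r)) * \<bar>g (x + r) - g x\<bar> \<le> 1 * \<bar>g (x + r) - g x\<bar>"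
        by (intro mult_right_mono le1) auto
      also have "\<dots> \<le> 3 * \<rho> * (h (x + r) + h x)" using g_diff[OF x r] by simp
      finally show "norm (\<psi> (x + r) * of_real (g (x + r) - g x)) \<le> 3 * \<rho> * (h (x + r) + h x)"
        unfolding norm_mult norm_of_real .
    qed
    have sH: "H summable_on R" using H by (rule has_sum_imp_summable)
    have "(\<lambda>x. norm (D x)) summable_on R" by (rule summable_on_comparison_test[OF sH DH]) simp_all
    hence sD: "D summable_on R" by (rule abs_summable_summable)
    have "cmod (infsum D R) \<le> infsum H R"
      by (rule norm_infsum_le[OF has_sum_infsum[OF sD] has_sum_infsum[OF sH] DH])
    also have "\<dots> = card T * (6 * \<rho> * infsum h R)" using H by (simp add: has_sum_iff)
    finally have "real (card T) * cmod L \<le> card T * (6 * \<rho> * infsum h R)"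
      unfolding LD[symmetric] by (simp add: norm_mult)
    moreover have "card T > 0" using T by auto
    ultimately show ?thesis by (simp add: L_def g_def)
  qed
  thus ?thesis by blast
qed

section \<open>Divisibility and irreducible elements\<close>

definition rdvd :: "complex \<Rightarrow> complex \<Rightarrow> bool" where
  "rdvd a b \<longleftrightarrow> (\<exists>y\<in>R. b = a * y)"

text \<open>The units are taken to be 1 and -1; the agreement with irreducibility in the ring rests
  on the later locale assumption \<open>units\<close>.\<close>

definition irr :: "complex \<Rightarrow> bool" where
  "irr x \<longleftrightarrow> x \<in> R \<and> x \<noteq> 0 \<and> x \<noteq> 1 \<and> x \<noteq> -1 \<and>
     (\<forall>a\<in>R. \<forall>b\<in>R. x = a * b \<longrightarrow> a \<in> {1, -1} \<or> b \<in> {1, -1})"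

lemma rdvd_refl: "rdvd a a" by (auto simp: rdvd_def intro!: bexI[of _ 1])

lemma rdvd_mult: "rdvd a b \<Longrightarrow> c \<in> R \<Longrightarrow> rdvd a (b * c)" "rdvd a b \<Longrightarrow> c \<in> R \<Longrightarrow> rdvd a (c * b)"
  by (auto simp: rdvd_def mult_ac)

lemma rdvd_add: "rdvd a b \<Longrightarrow> rdvd a c \<Longrightarrow> rdvd a (b + c)"
  by (auto simp: rdvd_def simp flip: distrib_left)

lemma rdvd_diff: "rdvd a b \<Longrightarrow> rdvd a c \<Longrightarrow> rdvd a (b - c)"
  by (auto simp: rdvd_def simp flip: right_diff_distrib)

lemma rdvd_minus_left: "rdvd a b \<Longrightarrow> rdvd (- a) b"
  unfolding rdvd_def by (metis R_minus minus_mult_minus)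

text \<open>Contains exactly one of x and -x for every nonzero x. Intersecting the irreducible
  elements with it, as \<open>P\<close> does, picks one out of each pair q, -q.\<close>

definition half_plane :: "complex set" where
  "half_plane = {x. Im x > 0 \<or> (Im x = 0 \<and> Re x > 0)}"

definition P :: "complex set" where "P = {q \<in> half_plane. irr q}"

lemma irr_minus: assumes "irr x" shows "irr (- x)"
proof -
  have "a \<in> {1, -1} \<or> b \<in> {1, -1}" if "a \<in> R" "b \<in> R" "- x = a * b" for a b
  proof -
    have "x = (- a) * b" using that(3) by (metis minus_minus mult_minus_left)
    hence "- a \<in> {1, -1} \<or> b \<in> {1, -1}" using that R_minus[of a] assms unfolding irr_def by blast
    thus ?thesis by (auto simp: minus_equation_iff)
  qed
  thus ?thesis using assms unfolding irr_def by (auto simp: minus_equation_iff)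
qed

lemma half_plane_cases: "x \<noteq> 0 \<Longrightarrow> x \<in> half_plane \<or> - x \<in> half_plane"
  by (auto simp: half_plane_def complex_eq_iff) 

lemma half_plane_minus: "x \<in> half_plane \<Longrightarrow> - x \<notin> half_plane"
  by (auto simp: half_plane_def) 

lemma irr_cases: "irr q \<Longrightarrow> q \<in> P \<or> - q \<in> P"
  using half_plane_cases[of q] irr_minus[of q] by (auto simp: P_def irr_def)

end

text \<open>The units of \<open>R\<close> are its elements of absolute value 1, so the assumption
  leaves only 1 and -1. It excludes the Gaussian and the Eisenstein integers.\<close>

locale imag_quad_units = imag_quad +
  assumes units: "x \<in> R \<Longrightarrow> cmod x = 1 \<Longrightarrow> x = 1 \<or> x = -1"
begin

lemma norm_gt_1: "x \<in> R \<Longrightarrow> x \<noteq> 0 \<Longrightarrow> x \<noteq> 1 \<Longrightarrow> x \<noteq> -1 \<Longrightarrow> cmod x > 1"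
  using norm_ge_1[of x] units[of x] by force

lemma irr_norm_sq_ge_2: assumes "irr q" shows "(cmod q)\<^sup>2 \<ge> 2"
proof -
  have "cmod q > 1" using assms by (intro norm_gt_1) (auto simp: irr_def)
  hence "(cmod q)\<^sup>2 > 1" by simp
  moreover obtain N where "(cmod q)\<^sup>2 = real N" using norm_sq_int assms by (auto simp: irr_def)
  ultimately show ?thesis by simp
qed

lemma unit_factors:
  assumes "x \<in> R" "y \<in> R" "x * y = 1 \<or> x * y = -1"
  shows "x \<in> {1, -1}"
proof (rule ccontr)
  assume "x \<notin> {1, -1}"
  moreover have "x \<noteq> 0" "y \<noteq> 0" using assms(3) by auto
  ultimately have *: "cmod x > 1" "cmod y \<ge> 1" using assms norm_gt_1[of x] norm_ge_1[of y] by auto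
  hence "cmod x * 1 \<le> cmod x * cmod y" by (intro mult_left_mono) auto
  hence "cmod (x * y) > 1" using * by (simp add: norm_mult)
  thus False using assms(3) by auto
qed

lemma ex_irr_factor:
  assumes "x \<in> R" "x \<noteq> 0" "x \<noteq> 1" "x \<noteq> -1"
  shows "\<exists>q. irr q \<and> rdvd q x"
  using assms
\<comment> \<open>The norm |x|^2 is a natural number that drops when a non-unit factor is split off;
  the floor merely gives it the type \<open>nat\<close>.\<close>
proof (induction "nat \<lfloor>(cmod x)\<^sup>2\<rfloor>" arbitrary: x rule: less_induct)
  case less
  show ?case
  proof (cases "irr x")
    case False
    then obtain a b where ab: "a \<in> R" "b \<in> R" "x = a * b" "a \<notin> {1, -1}" "b \<notin> {1, -1}"
      using less.prems by (auto simp: irr_def)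
    with less.prems have "a \<noteq> 0" "b \<noteq> 0" by auto
    hence "cmod a > 0" "cmod b > 1" using ab norm_gt_1[of b] by auto
    hence "cmod a < cmod x" by (simp add: ab(3) norm_mult)
    hence lt: "(cmod a)\<^sup>2 < (cmod x)\<^sup>2" by (intro power_strict_mono) auto
    obtain M where "(cmod a)\<^sup>2 = real M" using norm_sq_int[OF ab(1)] by blast
    moreover obtain N where "(cmod x)\<^sup>2 = real N" using norm_sq_int[OF less.prems(1)] by blast
    ultimately have "nat \<lfloor>(cmod a)\<^sup>2\<rfloor> < nat \<lfloor>(cmod x)\<^sup>2\<rfloor>" using lt by simp
    from less.hyps[OF this] ab \<open>a \<noteq> 0\<close> obtain q where "irr q" "rdvd q a" by auto
    thus ?thesis using rdvd_mult(1)[of q a b] ab by auto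
  qed (auto intro: rdvd_refl)
qed

lemma ex_P_factor:
  assumes "x \<in> R" "x \<noteq> 0" "x \<noteq> 1" "x \<noteq> -1"
  shows "\<exists>q\<in>P. rdvd q x"
  using ex_irr_factor[OF assms] irr_cases rdvd_minus_left by blast

lemma P_rdvd_eq: assumes "q \<in> P" "q' \<in> P" "rdvd q q'" shows "q = q'"
proof -
  from assms obtain y where y: "y \<in> R" "q' = q * y" by (auto simp: rdvd_def)
  have "y \<in> {1, -1}" using assms y by (force simp: P_def irr_def)
  thus ?thesis using assms y half_plane_minus[of q] by (auto simp: P_def)
qed

end

section \<open>Sieving and Euler products\<close>

locale imag_quad_ufd = imag_quad_units +
  assumes irr_prime: "irr q \<Longrightarrow> x \<in> R \<Longrightarrow> y \<in> R \<Longrightarrow> rdvd q (x * y) \<Longrightarrow> rdvd q x \<or> rdvd q y"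
begin

definition sieved :: "complex set \<Rightarrow> complex set" where
  "sieved A = {x \<in> R. x \<noteq> 0 \<and> (\<forall>q\<in>A. \<not> rdvd q x)}"

lemma P_R: "q \<in> P \<Longrightarrow> q \<in> R" "q \<in> P \<Longrightarrow> q \<noteq> 0" by (auto simp: P_def irr_def)

text \<open>Since q is prime, \<open>sieved A\<close> is the disjoint union of
  \<open>sieved (insert q A)\<close> and q times \<open>sieved A\<close>. Multiplicativity turns the
  sum over the second piece into f(q) times the whole, so each sieving step multiplies the sum by 1
  - f(q).\<close>

lemma sieve:
  fixes f :: "complex \<Rightarrow> complex"
  assumes mult: "\<And>x y. x \<in> R \<Longrightarrow> y \<in> R \<Longrightarrow> f (x * y) = f x * f y"
    and summable: "f summable_on R"
    and A: "finite A" "A \<subseteq> P"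
  shows "infsum f (sieved A) = (\<Prod>q\<in>A. 1 - f q) * infsum f (R - {0})"
  using A
proof (induction A)
  case empty
  have "sieved {} = R - {0}" by (auto simp: sieved_def)
  thus ?case by simp
next
  case (insert q A)
  have q: "q \<in> R" "q \<noteq> 0" "irr q" using insert P_R by (auto simp: P_def)
  have sub: "sieved B \<subseteq> R" for B by (auto simp: sieved_def)
  have sm: "f summable_on B" if "B \<subseteq> R" for B using summable_on_subset_banach[OF summable that] .
  have eq: "sieved A = sieved (insert q A) \<union> (\<lambda>x. q * x) ` sieved A"
  proof (intro equalityI subsetI)
    fix x assume x: "x \<in> sieved A"
    show "x \<in> sieved (insert q A) \<union> (\<lambda>x. q * x) ` sieved A"
    proof (cases "rdvd q x")
      case True
      then obtain y where y: "y \<in> R" "x = q * y" by (auto simp: rdvd_def)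
      have "\<not> rdvd r y" if "r \<in> A" for r
        using x that rdvd_mult(2)[of r y q] q y by (auto simp: sieved_def)
      hence "y \<in> sieved A" using x y by (auto simp: sieved_def)
      with y show ?thesis by blast
    qed (use x in \<open>auto simp: sieved_def\<close>)
  next
    fix x assume "x \<in> sieved (insert q A) \<union> (\<lambda>x. q * x) ` sieved A"
    thus "x \<in> sieved A"
    proof
      assume "x \<in> (\<lambda>x. q * x) ` sieved A"
      then obtain y where y: "y \<in> sieved A" "x = q * y" by blast
      have "\<not> rdvd r x" if r: "r \<in> A" for r
      proof
        assume "rdvd r x"
        have "r \<in> P" using r insert.prems by auto
        hence "rdvd r q \<or> rdvd r y" using irr_prime[of r q y] y q \<open>rdvd r x\<close> by (auto simp: P_def sieved_def)
        thus False using P_rdvd_eq[of r q] r y \<open>r \<in> P\<close> insert by (auto simp: sieved_def)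
      qed
      thus "x \<in> sieved A" using y q by (auto simp: sieved_def)
    qed (auto simp: sieved_def)
  qed
  have disj: "sieved (insert q A) \<inter> (\<lambda>x. q * x) ` sieved A = {}" by (auto simp: sieved_def rdvd_def)
  have img: "(\<lambda>x. q * x) ` sieved A \<subseteq> R" using q by (auto simp: sieved_def)
  have "infsum f (sieved A) = infsum f (sieved (insert q A)) + infsum f ((\<lambda>x. q * x) ` sieved A)"
    by (subst eq, rule infsum_Un_disjoint) (use disj sub img in \<open>auto intro!: sm\<close>)
  also have "infsum f ((\<lambda>x. q * x) ` sieved A) = (\<Sum>\<^sub>\<infinity>x\<in>sieved A. f (q * x))"
    using q by (subst infsum_reindex) (auto simp: inj_on_def o_def)
  also have "\<dots> = (\<Sum>\<^sub>\<infinity>x\<in>sieved A. f q * f x)"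
    by (intro infsum_cong mult q) (auto simp: sieved_def)
  also have "\<dots> = f q * infsum f (sieved A)" by (rule infsum_cmult_right') 
  finally have "infsum f (sieved (insert q A)) = infsum f (sieved A) - f q * infsum f (sieved A)"
    by (rule add_implies_diff[OF sym])
  also have "\<dots> = (1 - f q) * infsum f (sieved A)" by (simp add: left_diff_distrib)
  also have "infsum f (sieved A) = (\<Prod>q\<in>A. 1 - f q) * infsum f (R - {0})" using insert by blast
  finally show ?case using insert.hyps by (simp add: mult.assoc)
qed

text \<open>After sieving by enough elements of \<open>P\<close>, only 1, -1 and points of small
  total weight survive; the 2 is f(1) + f(-1). The set \<open>A\<close> is chosen from the majorant
  \<open>g\<close> alone, before \<open>f\<close>, so that one \<open>A\<close> serves all
  characters simultaneously.\<close>

lemma euler_product_approx: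
  fixes g :: "complex \<Rightarrow> real"
  assumes g: "g summable_on R"
  shows "\<exists>A. finite A \<and> A \<subseteq> P \<and> (\<forall>f. (\<forall>x\<in>R. \<forall>y\<in>R. f (x * y) = f x * f y) \<and> f 1 = (1::complex) \<and> f (- 1) = 1 \<and>
      (\<forall>x\<in>R. cmod (f x) \<le> g x) \<longrightarrow> cmod ((\<Prod>q\<in>A. 1 - f q) * infsum f (R - {0}) - 2) \<le> 1)"
proof -
  obtain F where F: "finite F" "F \<subseteq> R" "dist (sum g F) (infsum g R) \<le> 1"
    using infsum_finite_approximation[OF g, of 1] by auto
  \<comment> \<open>For each nonzero non-unit x, \<open>c x\<close> is a divisor of x in
    \<open>P\<close>. Sieving by these divisors leaves no element of \<open>F\<close> other than 1
    and -1.\<close>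
  define c where "c = (\<lambda>x. SOME q. q \<in> P \<and> rdvd q x)"
  have c: "c x \<in> P" "rdvd (c x) x" if "x \<in> R" "x \<noteq> 0" "x \<noteq> 1" "x \<noteq> -1" for x
    using someI_ex[of "\<lambda>q. q \<in> P \<and> rdvd q x"] ex_P_factor[OF that] by (auto simp: c_def)
  define A where "A = c ` (F - {0, 1, -1})"
  have A: "finite A" "A \<subseteq> P" using F c by (auto simp: A_def)
  show ?thesis
  proof (intro exI conjI allI impI)
    fix f assume f: "(\<forall>x\<in>R. \<forall>y\<in>R. f (x * y) = f x * f y) \<and> f 1 = (1::complex) \<and> f (- 1) = 1 \<and> (\<forall>x\<in>R. cmod (f x) \<le> g x)"
    have sf: "(\<lambda>x. norm (f x)) summable_on R" using f by (intro summable_on_comparison_test[OF g]) auto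
    hence sf': "f summable_on R" by (rule abs_summable_summable)
    define S where "S = sieved A - {1, -1}"
    have not_unit: "\<not> rdvd q 1" "\<not> rdvd q (- 1)" if "q \<in> P" for q
    proof -
      have "q \<notin> {1, -1}" using that by (auto simp: P_def irr_def)
      thus "\<not> rdvd q 1" "\<not> rdvd q (- 1)"
        using unit_factors[OF P_R(1)[OF that]] unfolding rdvd_def by metis+
    qed
    have "1 \<in> sieved A" "-1 \<in> sieved A"
      using not_unit A(2) R_minus[OF R_1] unfolding sieved_def by auto
    hence eq: "sieved A = {1, -1} \<union> S" unfolding S_def by blast
    have SF: "S \<subseteq> R - F" using c by (auto simp: S_def sieved_def A_def)
    hence SR: "S \<subseteq> R" by blast
    have "infsum f (sieved A) = infsum f {1, -1} + infsum f S"
      unfolding eq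
      using infsum_Un_disjoint[OF summable_on_finite summable_on_subset_banach[OF sf' SR], of "{1, -1}"]
      by (simp add: S_def)
    also have "infsum f {1, -1} = 2" using f by simp
    finally have "infsum f (sieved A) - 2 = infsum f S" by simp
    moreover have "cmod (infsum f S) \<le> infsum g S"
      using summable_on_subset_banach[OF sf' SR] summable_on_subset_banach[OF g SR] f SR
      by (intro norm_infsum_le[OF has_sum_infsum has_sum_infsum]) auto
    moreover have "infsum g S \<le> infsum g (R - F)"
      using SF f by (intro infsum_mono2 summable_on_subset_banach[OF g]) (auto intro: order_trans[OF norm_ge_zero])
    moreover have "infsum g (R - F) = infsum g R - sum g F"
      using F g by (subst infsum_Diff) auto
    ultimately have "cmod (infsum f (sieved A) - 2) \<le> 1" using F(3) by (simp add: dist_real_def)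
    also have "infsum f (sieved A) = (\<Prod>q\<in>A. 1 - f q) * infsum f (R - {0})"
      using f by (intro sieve sf' A) auto
    finally show "cmod ((\<Prod>q\<in>A. 1 - f q) * infsum f (R - {0}) - 2) \<le> 1" .
  qed (use A in auto)
qed

end

subsection \<open>Characters of the residue index\<close>

definition zeta_char :: "nat \<Rightarrow> int \<Rightarrow> complex" where
  "zeta_char n k = cis (2 * pi * real_of_int k / real n)"

lemma zeta_char_add: "zeta_char n (a + b) = zeta_char n a * zeta_char n b"
  by (simp add: zeta_char_def cis_mult distrib_left add_divide_distrib)

lemma zeta_char_0 [simp]: "zeta_char n 0 = 1"
  by (simp add: zeta_char_def)

lemma norm_zeta_char [simp]: "cmod (zeta_char n k) = 1"
  by (simp add: zeta_char_def)

lemma Re_zeta_char: "Re (zeta_char n k) = cos (2 * pi * real_of_int k / real n)"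
  by (simp add: zeta_char_def)

lemma zeta_char_power: "zeta_char n k ^ j = zeta_char n (int j * k)"
  unfolding zeta_char_def Complex.DeMoivre by (simp add: mult_ac)

lemma Re_zeta_char_eq_1_iff:
  assumes "n > 0"
  shows "Re (zeta_char n k) = 1 \<longleftrightarrow> int n dvd k"
proof
  assume "Re (zeta_char n k) = 1"
  then obtain l :: int where "2 * pi * real_of_int k / real n = real_of_int l * 2 * pi"
    unfolding Re_zeta_char cos_one_2pi_int by blast
  hence "real_of_int k = real_of_int (int n * l)" using assms by (simp add: field_simps)
  hence "k = int n * l" by (simp only: of_int_eq_iff)
  thus "int n dvd k" by simp
next
  assume "int n dvd k"
  then obtain l where "k = int n * l" by (auto elim!: dvdE)
  hence "2 * pi * real_of_int k / real n = real_of_int l * 2 * pi" using assms by (simp add: field_simps)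
  thus "Re (zeta_char n k) = 1" unfolding Re_zeta_char cos_one_2pi_int by blast
qed

lemma zeta_char_eq_1_iff:
  assumes "n > 0"
  shows "zeta_char n k = 1 \<longleftrightarrow> int n dvd k"
proof -
  have "z = 1" if "cmod z = 1" "Re z = 1" for z
    using that by (auto simp: complex_eq_iff cmod_def)
  from this[of "zeta_char n k"] have "zeta_char n k = 1 \<longleftrightarrow> Re (zeta_char n k) = 1" by force
  thus ?thesis unfolding Re_zeta_char_eq_1_iff[OF assms] .
qed

lemma zeta_char_cong:
  assumes "n > 0" "[a = b] (mod int n)"
  shows "zeta_char n a = zeta_char n b"
proof -
  have "int n dvd a - b" using assms(2) by (simp add: cong_iff_dvd_diff)
  hence "zeta_char n (a - b) = 1" using zeta_char_eq_1_iff assms by blast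
  with zeta_char_add[of n "a - b" b] show ?thesis by simp
qed

lemma sum_zeta_char:
  assumes "n > 0"
  shows "(\<Sum>j<n. zeta_char n (int j * k)) = (if int n dvd k then of_nat n else 0)"
proof (cases "int n dvd k")
  case True
  have "zeta_char n (int j * k) = 1" for j
    unfolding zeta_char_eq_1_iff[OF assms] using True by simp
  thus ?thesis using True by simp
next
  case False
  define z where "z = zeta_char n k"
  have "z \<noteq> 1" unfolding z_def zeta_char_eq_1_iff[OF assms] by (rule False)
  have "z ^ n = 1" unfolding z_def zeta_char_power zeta_char_eq_1_iff[OF assms] by simp
  have "(\<Sum>j<n. zeta_char n (int j * k)) = (\<Sum>j<n. z ^ j)" unfolding z_def zeta_char_power ..
  also have "\<dots> = 0" using \<open>z \<noteq> 1\<close> \<open>z ^ n = 1\<close> by (simp add: geometric_sum)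
  finally show ?thesis using False by simp
qed

lemma sum_Re_zeta_char:
  assumes "n > 0"
  shows "(\<Sum>j<n. Re (zeta_char n (int j * k))) = (if int n dvd k then real n else 0)"
proof -
  have "(\<Sum>j<n. Re (zeta_char n (int j * k))) = Re (\<Sum>j<n. zeta_char n (int j * k))" by simp
  thus ?thesis using sum_zeta_char[OF assms, of k] by simp
qed

text \<open>The weights \<open>a\<close> are the Fourier coefficients of a function on \<open>\<int>/n\<close> that is
  positive at most at \<open>\<plusminus>1\<close>; only the trivial character has a positive coefficient.\<close>

lemma ex_weights:
  fixes n :: nat
  assumes "n \<ge> 2"
  obtains a :: "nat \<Rightarrow> real" where "a 0 > 0" "\<And>j. 1 \<le> j \<Longrightarrow> j < n \<Longrightarrow> a j \<le> 0"
    "\<And>k. \<not> [k = 1] (mod int n) \<Longrightarrow> \<not> [k = -1] (mod int n) \<Longrightarrow>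
       (\<Sum>j<n. a j * Re (zeta_char n (int j * k))) \<le> 0"
proof -
  \<comment> \<open>The largest of 0 and the cosines cos(2 pi j / n) with 1 \<le> j < n. Subtracting
    it makes the weights with j \<noteq> 0 nonpositive; it is below 1, so the weight at 0 stays
    positive.\<close>
  define \<kappa> where "\<kappa> = Max (insert 0 ((\<lambda>j. Re (zeta_char n (int j))) ` {1..<n}))"
  have n: "n > 0" using assms by simp
  have lt1: "Re (zeta_char n (int j)) < 1" if "j \<in> {1..<n}" for j
  proof -
    have "Re (zeta_char n (int j)) \<noteq> 1" unfolding Re_zeta_char_eq_1_iff[OF n] using that by (auto dest: dvd_imp_le)
    moreover have "Re (zeta_char n (int j)) \<le> 1" by (simp add: Re_zeta_char)
    ultimately show ?thesis by simp
  qed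
  have \<kappa>: "\<kappa> \<ge> 0" "\<kappa> < 1" unfolding \<kappa>_def using lt1 by (auto intro!: Max_ge)
  have \<kappa>_ge: "Re (zeta_char n (int j)) \<le> \<kappa>" if "j \<in> {1..<n}" for j
    unfolding \<kappa>_def using that by (intro Max_ge) auto
  show ?thesis
  \<comment> \<open>The cosine transforms to a multiple of the indicator of the classes 1 and -1,
    and the constant \<kappa> to n \<kappa> times the indicator of the class 0. The latter enters
    with a minus sign, which is why 0 was inserted to make \<kappa> \<ge> 0.\<close>
  proof (rule that[of "\<lambda>j. Re (zeta_char n (int j)) - \<kappa>"])
    fix k assume k: "\<not> [k = 1] (mod int n)" "\<not> [k = -1] (mod int n)"
    have "\<not> int n dvd 1 - k" "\<not> int n dvd 1 + k"
      using k by (auto simp: cong_iff_dvd_diff dvd_diff_commute add.commute)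
    hence z: "(\<Sum>j<n. Re (zeta_char n (int j * (1 - k)))) = 0" "(\<Sum>j<n. Re (zeta_char n (int j * (1 + k)))) = 0"
      by (simp_all only: sum_Re_zeta_char[OF n] if_False)
    have "Re (zeta_char n (int j)) * Re (zeta_char n (int j * k)) =
        (Re (zeta_char n (int j * (1 - k))) + Re (zeta_char n (int j * (1 + k)))) / 2" for j
      unfolding Re_zeta_char cos_times_cos by (simp add: algebra_simps diff_divide_distrib add_divide_distrib)
    hence "(\<Sum>j<n. Re (zeta_char n (int j)) * Re (zeta_char n (int j * k))) = 0"
      by (simp only: sum_divide_distrib[symmetric] sum.distrib z) simp
    moreover have "\<kappa> * (\<Sum>j<n. Re (zeta_char n (int j * k))) \<ge> 0"
      unfolding sum_Re_zeta_char[OF n] using \<kappa> by simp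
    ultimately show "(\<Sum>j<n. (Re (zeta_char n (int j)) - \<kappa>) * Re (zeta_char n (int j * k))) \<le> 0"
      by (simp only: left_diff_distrib sum_subtractf sum_distrib_left)
  qed (use \<kappa> \<kappa>_ge in auto)
qed

text \<open>The real part of -Ln(1 - z) is -ln |1 - z|, with linear term Re z and remainder at most
  |z|^2 / (1 - |z|).\<close>

lemma ln_norm_one_minus_bound:
  fixes z :: complex
  assumes "cmod z \<le> 1 / 2"
  shows "\<bar>- ln (cmod (1 - z)) - Re z\<bar> \<le> 2 * (cmod z)\<^sup>2"
proof -
  have "1 - z \<noteq> 0" using assms by auto
  hence eq: "Re (ln (1 + (- z)) - (- z)) = ln (cmod (1 - z)) + Re z" by simp
  have "\<bar>- ln (cmod (1 - z)) - Re z\<bar> = \<bar>Re (ln (1 + (- z)) - (- z))\<bar>" unfolding eq by linarith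
  also have "\<dots> \<le> cmod (ln (1 + (- z)) - (- z))" by (rule abs_Re_le_cmod)
  also have "\<dots> \<le> (cmod (- z))\<^sup>2 / (1 - cmod (- z))" using assms by (intro Ln_approx_linear) auto
  also have "\<dots> \<le> (cmod (- z))\<^sup>2 / (1 / 2)"
    using assms by (intro divide_left_mono mult_pos_pos) simp_all
  also have "\<dots> = 2 * (cmod z)\<^sup>2" by simp
  finally show ?thesis .
qed

section \<open>Residue classes modulo p and their characters\<close>

context imag_quad
begin

definition residue_set :: "nat \<Rightarrow> complex set" where
  "residue_set p = (\<lambda>(a, b). of_int a + of_int b * w) ` ({0..<int p} \<times> {0..<int p})"

lemma residue_set: "finite (residue_set p)" "residue_set p \<subseteq> R" "p > 0 \<Longrightarrow> residue_set p \<noteq> {}"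
  by (auto simp: residue_set_def)

lemma card_residue_set: "card (residue_set p) = p\<^sup>2"
proof -
  have "inj_on (\<lambda>(a, b). of_int a + of_int b * w) ({0..<int p} \<times> {0..<int p})"
    by (auto simp: inj_on_def pair_eq_iff)
  thus ?thesis unfolding residue_set_def by (simp add: card_image power2_eq_square)
qed

lemma ex_residue: assumes "p > 0" "x \<in> R" shows "\<exists>r\<in>residue_set p. rdvd (of_nat p) (x - r)"
proof -
  obtain a b where x: "x = of_int a + of_int b * w" using assms by (elim R_E)
  define r where "r = of_int (a mod int p) + of_int (b mod int p) * w"
  have "r \<in> residue_set p" using assms by (auto simp: r_def residue_set_def)
  moreover have "x = r + of_nat p * (of_int (a div int p) + of_int (b div int p) * w)"
  proof -
    have "x = of_int (int p * (a div int p) + a mod int p) + of_int (int p * (b div int p) + b mod int p) * w"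
      by (simp add: x)
    thus ?thesis by (simp only: of_int_add of_int_mult of_int_of_nat_eq) (simp add: r_def algebra_simps)
  qed
  hence "rdvd (of_nat p) (x - r)" unfolding rdvd_def by auto
  ultimately show ?thesis by blast
qed

lemma residue_set_unique:
  assumes "r \<in> residue_set p" "r' \<in> residue_set p" "rdvd (of_nat p) (r - r')"
  shows "r = r'"
proof -
  obtain a b c d where r: "r = of_int a + of_int b * w" "r' = of_int c + of_int d * w"
    and bounds: "0 \<le> a" "a < int p" "0 \<le> b" "b < int p" "0 \<le> c" "c < int p" "0 \<le> d" "d < int p"
    using assms by (auto simp: residue_set_def)
  have "r - r' = of_int (a - c) + of_int (b - d) * w" by (simp add: r algebra_simps)
  hence "\<exists>z\<in>R. of_int (a - c) + of_int (b - d) * w = of_int (int p) * z"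
    using assms(3) by (simp add: rdvd_def)
  hence "int p dvd a - c" "int p dvd b - d" unfolding int_mult_dvd by auto
  hence "a mod int p = c mod int p" "b mod int p = d mod int p" by (simp_all add: mod_eq_dvd_iff)
  thus ?thesis using bounds by (simp add: r)
qed

end

text \<open>An abstract discrete logarithm: on elements prime to p, \<open>ind\<close> read modulo n
  is a homomorphism from the unit group of R/pR onto Z/n whose kernel consists of the classes of
  rational integers. It is instantiated later with n = p + 1.\<close>

locale residue_index = imag_quad_ufd +
  fixes p n :: nat and ind :: "complex \<Rightarrow> int"
  assumes p_ge_2: "p \<ge> 2" and n_ge_2: "n \<ge> 2"
    and p_prime: "x \<in> R \<Longrightarrow> y \<in> R \<Longrightarrow> rdvd (of_nat p) (x * y) \<Longrightarrow> rdvd (of_nat p) x \<or> rdvd (of_nat p) y"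
    and ind_mult: "x \<in> R \<Longrightarrow> y \<in> R \<Longrightarrow> \<not> rdvd (of_nat p) x \<Longrightarrow> \<not> rdvd (of_nat p) y \<Longrightarrow>
        [ind (x * y) = ind x + ind y] (mod int n)"
    and ind_cong: "x \<in> R \<Longrightarrow> y \<in> R \<Longrightarrow> \<not> rdvd (of_nat p) x \<Longrightarrow> rdvd (of_nat p) (x - y) \<Longrightarrow>
        [ind x = ind y] (mod int n)"
    and ind_eq_0_iff: "x \<in> R \<Longrightarrow> \<not> rdvd (of_nat p) x \<Longrightarrow>
        [ind x = 0] (mod int n) \<longleftrightarrow> (\<exists>c. rdvd (of_nat p) (x - of_int c))"
    and ex_ind_1: "\<exists>\<gamma>\<in>R. \<not> rdvd (of_nat p) \<gamma> \<and> [ind \<gamma> = 1] (mod int n)"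
begin

text \<open>The j-th character of the index group, lifted to \<open>R\<close> in the manner of a
  Dirichlet character.\<close>

definition \<psi> :: "nat \<Rightarrow> complex \<Rightarrow> complex" where
  "\<psi> j x = (if rdvd (of_nat p) x then 0 else zeta_char n (int j * ind x))"

lemma n_pos: "n > 0" using n_ge_2 by simp

lemma not_p_dvd_unit: "\<not> rdvd (of_nat p) 1" "\<not> rdvd (of_nat p) (- 1)"
proof -
  have "(of_nat p :: complex) \<notin> {1, -1}" using p_ge_2 by (auto simp: complex_eq_iff)
  thus "\<not> rdvd (of_nat p) 1" "\<not> rdvd (of_nat p) (- 1)"
    using unit_factors[OF R_nat, of _ p] unfolding rdvd_def by metis+
qed

lemma ind_int: assumes "\<not> rdvd (of_nat p) (of_int c)" shows "[ind (of_int c) = 0] (mod int n)"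
proof -
  have "rdvd (of_nat p) (of_int c - of_int c)" by (auto simp: rdvd_def intro!: bexI[of _ 0])
  thus ?thesis using ind_eq_0_iff[OF R_int assms] by blast
qed

lemma \<psi>_mult: assumes "x \<in> R" "y \<in> R" shows "\<psi> j (x * y) = \<psi> j x * \<psi> j y"
proof (cases "rdvd (of_nat p) x \<or> rdvd (of_nat p) y")
  case True
  thus ?thesis using rdvd_mult assms by (auto simp: \<psi>_def)
next
  case False
  hence "\<not> rdvd (of_nat p) (x * y)" using p_prime assms by blast
  moreover have "zeta_char n (int j * ind (x * y)) = zeta_char n (int j * (ind x + ind y))"
    using False by (intro zeta_char_cong n_pos cong_mult cong_refl ind_mult assms) auto
  ultimately show ?thesis using False by (simp add: \<psi>_def distrib_left zeta_char_add)
qed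

lemma norm_\<psi>: "cmod (\<psi> j x) \<le> 1" by (simp add: \<psi>_def)

lemma \<psi>_1: "\<psi> j 1 = 1"
proof -
  have "\<psi> j 1 = \<psi> j 1 * \<psi> j 1" using \<psi>_mult[of 1 1 j] by simp
  moreover have "\<psi> j 1 \<noteq> 0" using not_p_dvd_unit norm_zeta_char[of n "int j * ind 1"] by (auto simp: \<psi>_def simp del: norm_zeta_char)
  ultimately show ?thesis by simp
qed

text \<open>As a rational integer prime to p, -1 has index 0. Thus associates have the same
  character value, and f(1) + f(-1) = 2 in the Euler product.\<close>

lemma \<psi>_minus_1: "\<psi> j (- 1) = 1"
proof -
  have "zeta_char n (int j * ind (- 1)) = zeta_char n (int j * 0)"
    using ind_int[of "- 1"] not_p_dvd_unit by (intro zeta_char_cong n_pos cong_mult cong_refl) simp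
  thus ?thesis using not_p_dvd_unit by (simp add: \<psi>_def)
qed

lemma \<psi>_cong: assumes "x \<in> R" "y \<in> R" "rdvd (of_nat p) (x - y)" shows "\<psi> j x = \<psi> j y"
proof (cases "rdvd (of_nat p) x")
  case True
  thus ?thesis using rdvd_diff[OF True assms(3)] by (simp add: \<psi>_def)
next
  case False
  moreover have "\<not> rdvd (of_nat p) y" using rdvd_add[OF _ assms(3), of y] False by auto
  moreover have "zeta_char n (int j * ind x) = zeta_char n (int j * ind y)"
    using False assms by (intro zeta_char_cong n_pos cong_mult cong_refl ind_cong) auto
  ultimately show ?thesis by (simp add: \<psi>_def)
qed

abbreviation "reps \<equiv> residue_set p"

lemma p_pos: "p > 0" using p_ge_2 by simp

lemmas reps = residue_set(1,2)[of p] residue_set(3)[OF p_pos]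

text \<open>A map that is injective modulo p permutes the finitely many residue classes, and \<psi>
  depends on the class only. It is applied to multiplication by an element prime to p and to
  translations.\<close>

lemma sum_reps_reindex:
  assumes \<sigma>: "\<And>r. r \<in> reps \<Longrightarrow> \<sigma> r \<in> R"
    and inj: "\<And>r r'. r \<in> reps \<Longrightarrow> r' \<in> reps \<Longrightarrow> rdvd (of_nat p) (\<sigma> r - \<sigma> r') \<Longrightarrow> rdvd (of_nat p) (r - r')"
  shows "(\<Sum>r\<in>reps. \<psi> j (\<sigma> r)) = (\<Sum>r\<in>reps. \<psi> j r)"
proof -
  define red where "red = (\<lambda>x. SOME r. r \<in> reps \<and> rdvd (of_nat p) (x - r))"
  have red: "red x \<in> reps" "rdvd (of_nat p) (x - red x)" if "x \<in> R" for x
    using someI_ex[of "\<lambda>r. r \<in> reps \<and> rdvd (of_nat p) (x - r)"] ex_residue[OF p_pos that]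
    by (auto simp: red_def)
  have "inj_on (\<lambda>r. red (\<sigma> r)) reps"
  proof (rule inj_onI)
    fix r r' assume r: "r \<in> reps" "r' \<in> reps" and eq: "red (\<sigma> r) = red (\<sigma> r')"
    have "rdvd (of_nat p) ((\<sigma> r - red (\<sigma> r)) - (\<sigma> r' - red (\<sigma> r')))"
      by (intro rdvd_diff red \<sigma> r)
    hence "rdvd (of_nat p) (\<sigma> r - \<sigma> r')" by (simp add: eq)
    thus "r = r'" using inj r residue_set_unique by blast
  qed
  moreover have "(\<lambda>r. red (\<sigma> r)) ` reps \<subseteq> reps" using red \<sigma> by auto
  ultimately have "bij_betw (\<lambda>r. red (\<sigma> r)) reps reps"
    using endo_inj_surj[OF reps(1)] by (simp add: bij_betw_def)
  hence "(\<Sum>r\<in>reps. \<psi> j r) = (\<Sum>r\<in>reps. \<psi> j (red (\<sigma> r)))"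
    by (rule sum.reindex_bij_betw[symmetric])
  also have "\<dots> = (\<Sum>r\<in>reps. \<psi> j (\<sigma> r))"
  proof (intro sum.cong refl)
    fix r assume "r \<in> reps"
    hence \<sigma>r: "\<sigma> r \<in> R" by (rule \<sigma>)
    moreover have "red (\<sigma> r) \<in> R" using red(1)[OF \<sigma>r] reps by blast
    ultimately show "\<psi> j (red (\<sigma> r)) = \<psi> j (\<sigma> r)" using \<psi>_cong[of "\<sigma> r" "red (\<sigma> r)"] red by simp
  qed
  finally show ?thesis ..
qed

text \<open>Multiplication by an element \<gamma> of index 1 permutes the residues and multiplies
  their character sum by \<open>\<psi> j \<gamma>\<close>, which differs from 1 for 0 < j < n; so
  that sum vanishes. Translation by x permutes the residues too.\<close>

lemma sum_\<psi>_residues: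
  assumes "1 \<le> j" "j < n" "x \<in> R"
  shows "(\<Sum>r\<in>reps. \<psi> j (x + r)) = 0"
proof -
  obtain \<gamma> where \<gamma>: "\<gamma> \<in> R" "\<not> rdvd (of_nat p) \<gamma>" "[ind \<gamma> = 1] (mod int n)" using ex_ind_1 by blast
  define S where "S = (\<Sum>r\<in>reps. \<psi> j r)"
  have "\<psi> j \<gamma> = zeta_char n (int j * 1)"
    using \<gamma> by (simp only: \<psi>_def if_False) (intro zeta_char_cong n_pos cong_mult cong_refl)
  hence "\<psi> j \<gamma> \<noteq> 1" using assms n_pos by (auto simp: zeta_char_eq_1_iff dest: dvd_imp_le)
  have "\<psi> j \<gamma> * S = (\<Sum>r\<in>reps. \<psi> j (\<gamma> * r))"
    unfolding S_def sum_distrib_left using reps \<gamma> by (intro sum.cong refl \<psi>_mult[symmetric]) auto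
  also have "\<dots> = S" unfolding S_def
  proof (rule sum_reps_reindex)
    fix r r' assume r: "r \<in> reps" "r' \<in> reps" "rdvd (of_nat p) (\<gamma> * r - \<gamma> * r')"
    hence "rdvd (of_nat p) (\<gamma> * (r - r'))" by (simp add: right_diff_distrib)
    moreover have "r - r' \<in> R" using r reps by auto
    ultimately show "rdvd (of_nat p) (r - r')" using p_prime \<gamma> by blast
  qed (use \<gamma> reps in auto)
  finally have "(\<psi> j \<gamma> - 1) * S = 0" by (simp add: left_diff_distrib)
  hence "S = 0" using \<open>\<psi> j \<gamma> \<noteq> 1\<close> by simp
  moreover have "(\<Sum>r\<in>reps. \<psi> j (x + r)) = S" unfolding S_def
    by (rule sum_reps_reindex) (use assms reps in auto)
  ultimately show ?thesis by simp
qed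

end

subsection \<open>An irreducible element in a generating class\<close>

context residue_index
begin

lemma irr_norm_powr_le_half:
  assumes "irr q" "s \<ge> 2"
  shows "cmod q powr (- s) \<le> 1 / 2"
proof -
  have q: "(cmod q)\<^sup>2 \<ge> 2" by (rule irr_norm_sq_ge_2[OF assms(1)])
  have q0: "q \<in> R" "q \<noteq> 0" using assms by (auto simp: irr_def)
  have "cmod q powr (- s) \<le> cmod q powr (- 2)" using norm_ge_1[OF q0] assms by (intro powr_mono) auto
  also have "\<dots> = 1 / (cmod q)\<^sup>2" using q0 by (simp add: powr_minus_divide)
  also have "\<dots> \<le> 1 / 2" using q by (intro divide_left_mono) auto
  finally show ?thesis .
qed

theorem ex_irr_ind_unit:
  "\<exists>q. irr q \<and> \<not> rdvd (of_nat p) q \<and> ([ind q = 1] (mod int n) \<or> [ind q = -1] (mod int n))"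
proof (rule ccontr)
  assume neg: "\<not> ?thesis"
  obtain a :: "nat \<Rightarrow> real" where a0: "a 0 > 0" and aj: "\<And>j. 1 \<le> j \<Longrightarrow> j < n \<Longrightarrow> a j \<le> 0"
    and a_sum: "\<And>k. \<not> [k = 1] (mod int n) \<Longrightarrow> \<not> [k = -1] (mod int n) \<Longrightarrow>
       (\<Sum>j<n. a j * Re (zeta_char n (int j * k))) \<le> 0"
    using ex_weights[OF n_ge_2] by blast
  define f where "f = (\<lambda>j s x. \<psi> j x * of_real (cmod x powr (- s)))"
  define L where "L = (\<lambda>j s. infsum (f j s) R)"
  have "\<forall>j\<in>{1..<n}. \<exists>C. \<forall>s. 2 < s \<and> s \<le> 3 \<longrightarrow> cmod (L j s) \<le> C"
    unfolding L_def f_def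
    by (intro ballI character_sum_bounded[OF reps] norm_\<psi> sum_\<psi>_residues) auto
  then obtain c where c: "\<And>j s. j \<in> {1..<n} \<Longrightarrow> 2 < s \<Longrightarrow> s \<le> 3 \<Longrightarrow> cmod (L j s) \<le> c j"
    by metis
  \<comment> \<open>One bound for all nontrivial characters and all s; the summand 1 keeps
    \<open>C\<close> positive for the logarithm.\<close>
  define C where "C = 1 + (\<Sum>j\<in>{1..<n}. \<bar>c j\<bar>)"
  have C1: "C \<ge> 1" by (auto simp: C_def sum_nonneg)
  have LC: "cmod (L j s) \<le> C" if "j \<in> {1..<n}" "2 < s" "s \<le> 3" for j s
  proof -
    have "cmod (L j s) \<le> \<bar>c j\<bar>" using c[OF that] by simp
    also have "\<bar>c j\<bar> \<le> (\<Sum>j\<in>{1..<n}. \<bar>c j\<bar>)" using that by (intro member_le_sum) auto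
    finally show ?thesis by (simp add: C_def)
  qed
  \<comment> \<open>\<open>a'\<close> weighs the quadratic errors of the logarithms,
    \<open>S4\<close> majorizes their sum over the irreducible elements, \<open>M\<close> will bound
    \<open>a 0 * - ln (E 0)\<close>, and the 3 in \<open>B\<close> is the upper bound for
    \<open>E 0 * cmod (L 0 s)\<close>. None of these depends on s.\<close>
  define a' where "a' = (\<Sum>j<n. \<bar>a j\<bar>)"
  define S4 where "S4 = (\<Sum>\<^sub>\<infinity>x\<in>R. cmod x powr (- 4))"
  define M where "M = 2 * a' * S4 - (\<Sum>j\<in>{1..<n}. a j * ln C)"
  define B where "B = 3 * exp (M / a 0)"
  have summable_f: "(\<lambda>x. norm (f j s x)) summable_on R" if "s > 2" for j s
    by (rule summable_on_comparison_test[OF summable_norm_powr[OF that]])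
       (use mult_right_mono[OF norm_\<psi>] in \<open>auto simp: f_def norm_mult\<close>)
  have L0: "cmod (L 0 s) \<le> B" if s: "2 < s" "s \<le> 3" for s
  proof -
    obtain A where A: "finite A" "A \<subseteq> P"
      and A': "\<forall>f. (\<forall>x\<in>R. \<forall>y\<in>R. f (x * y) = f x * f y) \<and> f 1 = (1::complex) \<and> f (- 1) = 1 \<and>
        (\<forall>x\<in>R. cmod (f x) \<le> cmod x powr (- s)) \<longrightarrow> cmod ((\<Prod>q\<in>A. 1 - f q) * infsum f (R - {0}) - 2) \<le> 1"
      using euler_product_approx[OF summable_norm_powr[OF s(1)]] by (elim exE conjE)
    \<comment> \<open>The reciprocal of the absolute value of a partial Euler product. As
      \<open>E j * cmod (L j s)\<close> will lie between 1 and 3, \<open>- ln (E j)\<close> replaces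
      ln |L_j(s)| up to a bounded error.\<close>
    define E where "E = (\<lambda>j. \<Prod>q\<in>A. cmod (1 - f j s q))"
    have f_half: "cmod (f j s q) \<le> 1 / 2" if "q \<in> A" for j q
    proof -
      have "cmod (f j s q) \<le> 1 * cmod q powr (- s)"
        unfolding f_def norm_mult norm_of_real by (intro mult_mono norm_\<psi>) auto
      also have "\<dots> \<le> 1 / 2" using irr_norm_powr_le_half[of q s] that A s by (auto simp: P_def)
      finally show ?thesis .
    qed
    have f_ne_1: "cmod (1 - f j s q) > 0" if "q \<in> A" for j q
      using f_half[OF that, of j] by auto
    have E_pos: "E j > 0" for j unfolding E_def by (intro prod_pos f_ne_1)
    have "cmod ((\<Prod>q\<in>A. 1 - f j s q) * infsum (f j s) (R - {0}) - 2) \<le> 1" for j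
      by (intro A'[rule_format] conjI ballI)
         (simp_all add: f_def \<psi>_mult \<psi>_1 \<psi>_minus_1 norm_mult powr_mult norm_\<psi> mult_left_le_one_le)
    moreover have "infsum (f j s) (R - {0}) = L j s" for j
      unfolding L_def by (rule infsum_cong_neutral) (auto simp: f_def)
    ultimately have *: "cmod ((\<Prod>q\<in>A. 1 - f j s q) * L j s - 2) \<le> 1" for j by simp
    have EL: "cmod ((\<Prod>q\<in>A. 1 - f j s q) * L j s) = E j * cmod (L j s)" for j
      by (simp add: E_def norm_mult prod_norm)
    have EL1: "1 \<le> E j * cmod (L j s)" for j
      using *[of j] norm_triangle_ineq2[of 2 "(\<Prod>q\<in>A. 1 - f j s q) * L j s"] unfolding EL[symmetric]
      by (simp add: norm_minus_commute)
    have EL3: "E j * cmod (L j s) \<le> 3" for j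
      using *[of j] norm_triangle_ineq2[of "(\<Prod>q\<in>A. 1 - f j s q) * L j s" 2] unfolding EL[symmetric]
      by simp
    have lnE: "ln (E j) = (\<Sum>q\<in>A. ln (cmod (1 - f j s q)))" for j
      unfolding E_def using f_ne_1 A by (intro ln_prod) auto
    \<comment> \<open>To first order the left side is |q|^(-s) times the weighted character sum at
      \<open>ind q\<close>, which is at most 0 because q has neither index 1 nor -1; if p divides q,
      all terms vanish. The errors are of order |q|^(-2s) \<le> |q|^(-4).\<close>
    have term_bound: "(\<Sum>j<n. a j * - ln (cmod (1 - f j s q))) \<le> 2 * a' * cmod q powr (- 4)" if q: "q \<in> A" for q
    proof -
      have q': "irr q" "q \<in> R" "q \<noteq> 0" using q A P_R by (auto simp: P_def)
      define t where "t = cmod q powr (- s)"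
      have "t\<^sup>2 = cmod q powr (- 2 * s)" by (simp add: t_def power2_eq_square flip: powr_add)
      also have "\<dots> \<le> cmod q powr (- 4)" using s norm_ge_1[OF q'(2,3)] by (intro powr_mono) auto
      finally have t2: "t\<^sup>2 \<le> cmod q powr (- 4)" .
      have "(\<Sum>j<n. a j * - ln (cmod (1 - f j s q))) \<le> (\<Sum>j<n. a j * Re (f j s q) + \<bar>a j\<bar> * (2 * t\<^sup>2))"
      proof (rule sum_mono)
        fix j
        have "cmod (f j s q) \<le> 1 * t"
          unfolding f_def norm_mult norm_of_real t_def by (intro mult_mono norm_\<psi>) auto
        hence "(cmod (f j s q))\<^sup>2 \<le> t\<^sup>2" by (intro power_mono) auto
        with ln_norm_one_minus_bound[OF f_half[OF q, of j]]
        have "\<bar>- ln (cmod (1 - f j s q)) - Re (f j s q)\<bar> \<le> 2 * t\<^sup>2" by linarith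
        hence "\<bar>a j\<bar> * \<bar>- ln (cmod (1 - f j s q)) - Re (f j s q)\<bar> \<le> \<bar>a j\<bar> * (2 * t\<^sup>2)"
          by (intro mult_left_mono) auto
        hence "\<bar>a j * (- ln (cmod (1 - f j s q)) - Re (f j s q))\<bar> \<le> \<bar>a j\<bar> * (2 * t\<^sup>2)"
          by (simp only: abs_mult)
        hence "a j * (- ln (cmod (1 - f j s q)) - Re (f j s q)) \<le> \<bar>a j\<bar> * (2 * t\<^sup>2)" by (rule abs_le_D1)
        thus "a j * - ln (cmod (1 - f j s q)) \<le> a j * Re (f j s q) + \<bar>a j\<bar> * (2 * t\<^sup>2)"
          by (simp only: right_diff_distrib)
      qed
      also have "\<dots> = (\<Sum>j<n. a j * Re (f j s q)) + a' * (2 * t\<^sup>2)"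
        by (simp only: sum.distrib sum_distrib_right a'_def)
      also have "(\<Sum>j<n. a j * Re (f j s q)) \<le> 0"
      proof (cases "rdvd (of_nat p) q")
        case False
        have "(\<Sum>j<n. a j * Re (f j s q)) = (\<Sum>j<n. a j * Re (zeta_char n (int j * ind q))) * t"
          using False by (simp add: f_def \<psi>_def t_def sum_distrib_left mult_ac)
        also have "\<dots> \<le> 0" using neg False q' by (intro mult_nonpos_nonneg a_sum) (auto simp: t_def)
        finally show ?thesis .
      qed (simp add: f_def \<psi>_def)
      also have "0 + a' * (2 * t\<^sup>2) \<le> 2 * a' * cmod q powr (- 4)"
        using mult_left_mono[OF t2, of "2 * a'"] by (simp add: a'_def sum_nonneg mult_ac)
      finally show ?thesis by simp
    qed
    have "(\<Sum>j<n. a j * - ln (E j)) = (\<Sum>q\<in>A. \<Sum>j<n. a j * - ln (cmod (1 - f j s q)))"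
      unfolding lnE by (subst sum.swap) (simp add: sum_distrib_left sum_negf)
    also have "\<dots> \<le> (\<Sum>q\<in>A. 2 * a' * cmod q powr (- 4))" by (rule sum_mono[OF term_bound])
    also have "\<dots> = 2 * a' * (\<Sum>q\<in>A. cmod q powr (- 4))" by (rule sum_distrib_left[symmetric])
    also have "\<dots> \<le> 2 * a' * S4" unfolding S4_def
      using A P_R by (intro mult_left_mono finite_sum_le_infsum summable_norm_powr) (auto simp: a'_def sum_nonneg)
    finally have upper: "(\<Sum>j<n. a j * - ln (E j)) \<le> 2 * a' * S4" .
    \<comment> \<open>The upper bound \<open>C\<close> for |L_j(s)| gives
      \<open>- ln (E j) \<le> ln C\<close>; the nonpositive weight turns this into a lower
      bound.\<close>
    have lower: "a j * ln C \<le> a j * - ln (E j)" if j: "j \<in> {1..<n}" for j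
    proof -
      have "1 \<le> E j * C" using EL1[of j] mult_left_mono[OF LC[OF j s], of "E j"] E_pos[of j] by linarith
      hence "ln 1 \<le> ln (E j * C)" by (subst ln_le_cancel_iff) auto
      also have "\<dots> = ln (E j) + ln C" using E_pos[of j] C1 by (intro ln_mult_pos) auto
      finally have "- ln (E j) \<le> ln C" by simp
      thus ?thesis using aj[of j] j by (intro mult_left_mono_neg) auto
    qed
    \<comment> \<open>Separating the trivial character, the only one of positive weight, leaves an
      upper bound for \<open>- ln (E 0)\<close> and hence for |L_0(s)|.\<close>
    have "{..<n} = insert 0 {1..<n}" using n_pos by auto
    hence "(\<Sum>j<n. a j * - ln (E j)) = a 0 * - ln (E 0) + (\<Sum>j\<in>{1..<n}. a j * - ln (E j))" by simp
    moreover have "(\<Sum>j\<in>{1..<n}. a j * ln C) \<le> (\<Sum>j\<in>{1..<n}. a j * - ln (E j))"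
      by (intro sum_mono lower)
    ultimately have "a 0 * - ln (E 0) \<le> M" using upper unfolding M_def by linarith
    hence "- ln (E 0) \<le> M / a 0" using a0 by (simp add: field_simps)
    hence "exp (- ln (E 0)) \<le> exp (M / a 0)" by simp
    hence "inverse (E 0) \<le> exp (M / a 0)" using E_pos[of 0] by (simp add: exp_minus)
    moreover have "cmod (L 0 s) \<le> 3 * inverse (E 0)" using EL3[of 0] E_pos[of 0] by (simp add: field_simps)
    ultimately show ?thesis unfolding B_def by linarith
  qed
  obtain F where F: "finite F" "F \<subseteq> {x \<in> R. x \<noteq> 0 \<and> (\<exists>y\<in>R. x = of_nat p * y + 1)}"
      "(\<Sum>x\<in>F. cmod x powr (- 2)) > B"
    using norm_sq_sum_unbounded[of p B] p_ge_2 by auto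
  have F_not: "\<not> rdvd (of_nat p) x" if "x \<in> F" for x
  proof
    assume *: "rdvd (of_nat p) x"
    from that F(2) obtain y where y: "y \<in> R" "x = of_nat p * y + 1" by blast
    hence "rdvd (of_nat p) (of_nat p * y)" by (auto simp: rdvd_def)
    from rdvd_diff[OF * this] y show False using not_p_dvd_unit by simp
  qed
  have F_le: "(\<Sum>x\<in>F. cmod x powr (- s)) \<le> B" if s: "2 < s" "s \<le> 3" for s
  proof -
    \<comment> \<open>The trivial character is real and nonnegative, so |L_0(s)| is the full sum of
      absolute values and majorizes its part over \<open>F\<close>.\<close>
    have f0: "f 0 s x = of_real (norm (f 0 s x))" for x by (simp add: f_def \<psi>_def)
    have "((\<lambda>x. of_real (norm (f 0 s x)) :: complex) has_sum of_real (\<Sum>\<^sub>\<infinity>x\<in>R. norm (f 0 s x))) R"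
      by (intro has_sum_of_real has_sum_infsum summable_f s)
    hence "(f 0 s has_sum of_real (\<Sum>\<^sub>\<infinity>x\<in>R. norm (f 0 s x))) R"
      unfolding f0[symmetric] .
    hence "L 0 s = of_real (\<Sum>\<^sub>\<infinity>x\<in>R. norm (f 0 s x))" by (simp add: L_def infsumI)
    hence L_eq: "cmod (L 0 s) = (\<Sum>\<^sub>\<infinity>x\<in>R. norm (f 0 s x))" by (simp add: infsum_nonneg)
    have "(\<Sum>x\<in>F. cmod x powr (- s)) = (\<Sum>x\<in>F. norm (f 0 s x))"
      using F_not by (intro sum.cong refl) (simp add: f_def \<psi>_def norm_mult)
    also have "\<dots> \<le> cmod (L 0 s)" unfolding L_eq
      using F by (intro finite_sum_le_infsum summable_f s) auto
    finally show ?thesis using L0[OF s] by linarith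
  qed
  \<comment> \<open>The sum over the finite set \<open>F\<close> is continuous in s, so the bound
    for 2 < s \<le> 3 passes to s = 2, against the choice of \<open>F\<close>.\<close>
  have "((\<lambda>s. \<Sum>x\<in>F. cmod x powr (- s)) \<longlongrightarrow> (\<Sum>x\<in>F. cmod x powr (- 2))) (at_right 2)"
    using F(2) by (intro tendsto_sum tendsto_powr tendsto_intros) auto
  moreover have "eventually (\<lambda>s::real. (\<Sum>x\<in>F. cmod x powr (- s)) \<le> B) (at_right 2)"
    unfolding eventually_at_right_field by (intro exI[of _ 3]) (auto intro!: F_le)
  ultimately have "(\<Sum>x\<in>F. cmod x powr (- 2)) \<le> B" by (intro tendsto_upperbound) auto
  with F(3) show False by simp
qed

end

subsection \<open>Existence of the residue index\<close>

lemma (in domain) finite_imp_field: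
  assumes "finite (carrier R)"
  shows "field R"
proof (rule cring_fieldI2)
  show "\<zero> \<noteq> \<one>" by simp
next
  fix a assume a: "a \<in> carrier R" "a \<noteq> \<zero>"
  have "inj_on (\<lambda>x. a \<otimes> x) (carrier R)" using a by (auto simp: inj_on_def m_lcancel)
  moreover have "(\<lambda>x. a \<otimes> x) ` carrier R \<subseteq> carrier R" using a by auto
  ultimately have "(\<lambda>x. a \<otimes> x) ` carrier R = carrier R" using endo_inj_surj[OF assms] by blast
  hence "\<one> \<in> (\<lambda>x. a \<otimes> x) ` carrier R" by simp
  thus "\<exists>b\<in>carrier R. a \<otimes> b = \<one>" by force
qed

text \<open>The multiplicative group of a finite field is cyclic, of order one less than the field.
  The exponent \<open>l x\<close> is an arbitrary choice, meaningful only modulo that order.\<close>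

lemma (in field) ex_discrete_log:
  assumes fin: "finite (carrier R)"
  obtains g l where "g \<in> carrier R - {\<zero>}" "\<And>x. x \<in> carrier R - {\<zero>} \<Longrightarrow> g [^] (l x :: nat) = x"
    "\<And>i j :: nat. g [^] i = g [^] j \<longleftrightarrow> [int i = int j] (mod int (card (carrier R) - 1))"
proof -
  obtain g where g: "g \<in> carrier (Multiplicative_Group.mult_of R)" and gen: "carrier (Multiplicative_Group.mult_of R) = {g [^] i | i::nat. i \<in> UNIV}"
    using finite_field_mult_group_has_gen[OF fin] by (elim bexE)
  interpret G: group "Multiplicative_Group.mult_of R" by (rule field_mult_group)
  have finG: "finite (carrier (Multiplicative_Group.mult_of R))" using fin by (rule finite_mult_of)
  have pow: "x [^]\<^bsub>Multiplicative_Group.mult_of R\<^esub> (i::nat) = x [^] i" for x i by (simp add: Multiplicative_Group.nat_pow_mult_of)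
  have "carrier (Multiplicative_Group.mult_of R) = (\<lambda>i. g [^] i) ` {0..G.ord g - 1}"
    using gen G.ord_elems[OF finG g] unfolding pow by auto
  moreover have "inj_on (\<lambda>i. g [^] i) {0..G.ord g - 1}" using G.ord_inj[OF g] unfolding pow .
  ultimately have "card (carrier (Multiplicative_Group.mult_of R)) = card {0..G.ord g - 1}" using card_image by metis
  also have "\<dots> = G.ord g" using G.ord_ge_1[OF finG g] by simp
  finally have ord: "G.ord g = card (carrier R) - 1" using fin by simp
  show ?thesis
  proof (rule that[of g "\<lambda>x. SOME i. g [^] (i::nat) = x"])
    show "g [^] (SOME i. g [^] (i::nat) = x) = x" if "x \<in> carrier R - {\<zero>}" for x
    proof (rule someI_ex)
      have "x \<in> carrier (Multiplicative_Group.mult_of R)" using that by simp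
      then obtain i :: nat where "x = g [^] i" unfolding gen by blast
      thus "\<exists>i. g [^] (i::nat) = x" by blast
    qed
    fix i j :: nat
    have "g [^] i = g [^] j \<longleftrightarrow> g [^]\<^bsub>Multiplicative_Group.mult_of R\<^esub> int i = g [^]\<^bsub>Multiplicative_Group.mult_of R\<^esub> int j"
      by (simp add: int_pow_int pow)
    also have "\<dots> \<longleftrightarrow> int (G.ord g) dvd (int j - int i)" by (rule G.int_pow_eq[OF g])
    also have "\<dots> \<longleftrightarrow> [int i = int j] (mod int (card (carrier R) - 1))"
      unfolding ord by (simp add: cong_iff_dvd_diff dvd_diff_commute)
    finally show "g [^] i = g [^] j \<longleftrightarrow> [int i = int j] (mod int (card (carrier R) - 1))" .
  next
    show "g \<in> carrier R - {\<zero>}" using g by simp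
  qed
qed

lemma ring_on_simps:
  "carrier (ring_on S) = S" "x \<otimes>\<^bsub>ring_on S\<^esub> y = x * y" "x \<oplus>\<^bsub>ring_on S\<^esub> y = x + y"
  "\<one>\<^bsub>ring_on S\<^esub> = 1" "\<zero>\<^bsub>ring_on S\<^esub> = 0"
  by (simp_all add: ring_on_def ring_of_type_algebra_def)

lemma domain_ring_on:
  fixes S :: "'a::field set"
  assumes "0 \<in> S" "1 \<in> S" "\<And>x y. x \<in> S \<Longrightarrow> y \<in> S \<Longrightarrow> x + y \<in> S" "\<And>x. x \<in> S \<Longrightarrow> - x \<in> S"
    "\<And>x y. x \<in> S \<Longrightarrow> y \<in> S \<Longrightarrow> x * y \<in> S"
  shows "domain (ring_on S)"
proof -
  have "abelian_group (ring_on S)"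
    by (rule abelian_groupI) (use assms in \<open>auto simp: ring_on_simps algebra_simps intro!: bexI[of _ "- _"]\<close>)
  moreover have "comm_monoid (ring_on S)"
    by (rule comm_monoidI) (use assms in \<open>auto simp: ring_on_simps\<close>)
  ultimately have "cring (ring_on S)"
    by (rule cringI) (simp add: ring_on_simps algebra_simps)
  thus ?thesis by (auto simp: domain_def domain_axioms_def ring_on_simps)
qed

lemma finprod_ring_on:
  fixes f :: "'b \<Rightarrow> 'a::field"
  assumes "domain (ring_on S)" "finite I" "\<And>i. i \<in> I \<Longrightarrow> f i \<in> S"
  shows "(\<Otimes>\<^bsub>ring_on S\<^esub>i\<in>I. f i) = prod f I"
proof -
  interpret D: domain "ring_on S" by fact
  show ?thesis using assms(2,3)
    by (induction I) (auto simp: D.finprod_insert ring_on_simps Pi_def)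
qed

context imag_quad
begin

lemma domain_R: "domain (ring_on R)"
  by (rule domain_ring_on) auto

lemma PIdl_iff: assumes "a \<in> R" shows "x \<in> PIdl\<^bsub>ring_on R\<^esub> a \<longleftrightarrow> rdvd a x"
  by (auto simp: cgenideal_def ring_on_simps rdvd_def mult.commute)

end

text \<open>As p generates a prime ideal, R/pR is a finite domain with p^2 elements, hence a field.
  Its discrete logarithm lives modulo p^2 - 1; reading it modulo p + 1 divides out the subgroup of
  order p - 1, which is the image of the rational integers prime to p.\<close>

lemma (in imag_quad_ufd) ex_residue_index:
  fixes p :: nat
  assumes p: "Factorial_Ring.prime p"
    and prime_ideal: "primeideal (PIdl\<^bsub>ring_on R\<^esub> (of_nat p)) (ring_on R)"
  obtains ind where "residue_index w t m p (p + 1) ind"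
proof -
  define I where "I = PIdl\<^bsub>ring_on R\<^esub> (of_nat p)"
  interpret D: domain "ring_on R" by (rule domain_R)
  interpret I: primeideal I "ring_on R" unfolding I_def by (rule prime_ideal)
  define Q where "Q = ring_on R Quot I"
  interpret Q: domain Q unfolding Q_def by (rule I.quotient_is_domain)
  have I_iff: "x \<in> I \<longleftrightarrow> rdvd (of_nat p) x" for x unfolding I_def by (rule PIdl_iff) auto
  define h where "h = (\<lambda>x. I +>\<^bsub>ring_on R\<^esub> x)"
  have hom: "h \<in> ring_hom (ring_on R) Q" unfolding Q_def h_def by (rule I.rcos_ring_hom)
  have carrier_Q: "carrier Q = h ` R"
    by (auto simp: Q_def h_def FactRing_def A_RCOSETS_def RCOSETS_def a_r_coset_def ring_on_simps)
  have h_closed: "h x \<in> carrier Q" if "x \<in> R" for x using that by (simp add: carrier_Q)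
  have h_mult: "h (x * y) = h x \<otimes>\<^bsub>Q\<^esub> h y" if "x \<in> R" "y \<in> R" for x y
    using ring_hom_mult[OF hom] that by (simp add: ring_on_simps)
  have h_1: "h 1 = \<one>\<^bsub>Q\<^esub>" using ring_hom_one[OF hom] by (simp add: ring_on_simps)
  have minus: "x \<ominus>\<^bsub>ring_on R\<^esub> y = x - y" if "x \<in> R" "y \<in> R" for x y
  proof -
    have "y \<oplus>\<^bsub>ring_on R\<^esub> (- y) = \<zero>\<^bsub>ring_on R\<^esub>" by (simp add: ring_on_simps)
    hence "\<ominus>\<^bsub>ring_on R\<^esub> y = - y" using that by (intro D.minus_equality) (auto simp: ring_on_simps)
    thus ?thesis by (simp add: a_minus_def ring_on_simps)
  qed
  have h_eq: "h x = h y \<longleftrightarrow> rdvd (of_nat p) (x - y)" if "x \<in> R" "y \<in> R" for x y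
    using D.quotient_eq_iff_same_a_r_cos[OF I.is_ideal, of x y] that
    by (simp add: h_def I_iff minus ring_on_simps)
  have h_0: "h x = \<zero>\<^bsub>Q\<^esub> \<longleftrightarrow> rdvd (of_nat p) x" if "x \<in> R" for x
  proof -
    have "\<zero>\<^bsub>Q\<^esub> = h 0" using D.a_rcos_zero[OF I.is_ideal, of 0] by (simp add: Q_def FactRing_def h_def I_iff rdvd_def bexI[of _ 0])
    thus ?thesis using h_eq[of x 0] that by simp
  qed
  have p0: "p > 0" using p by (rule prime_gt_0_nat)
  have p2: "p \<ge> 2" using p by (rule prime_ge_2_nat)
  have "bij_betw h (residue_set p) (carrier Q)"
  proof (rule bij_betwI')
    show "h x = h y \<longleftrightarrow> x = y" if "x \<in> residue_set p" "y \<in> residue_set p" for x y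
      using that residue_set(2)[of p] h_eq[of x y] residue_set_unique[of x p y] by auto
    show "h x \<in> carrier Q" if "x \<in> residue_set p" for x
      using that residue_set(2)[of p] h_closed by auto
    show "\<exists>x\<in>residue_set p. y = h x" if y: "y \<in> carrier Q" for y
    proof -
      obtain x where x: "x \<in> R" "y = h x" using y carrier_Q by auto
      obtain r where "r \<in> residue_set p" "rdvd (of_nat p) (x - r)" using ex_residue[OF p0 x(1)] by auto
      thus ?thesis using h_eq[of x r] x residue_set(2)[of p] by auto
    qed
  qed
  hence card_Q: "card (carrier Q) = p\<^sup>2" and fin_Q: "finite (carrier Q)"
    using card_residue_set[of p] residue_set(1)[of p] by (auto dest: bij_betw_same_card bij_betw_finite)
  interpret Q: field Q by (rule Q.finite_imp_field[OF fin_Q])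
  have n: "p\<^sup>2 - 1 = (p + 1) * (p - 1)" using p0 by (simp add: power2_eq_square algebra_simps)
  obtain g l where g: "g \<in> carrier Q - {\<zero>\<^bsub>Q\<^esub>}" and l: "\<And>x. x \<in> carrier Q - {\<zero>\<^bsub>Q\<^esub>} \<Longrightarrow> g [^]\<^bsub>Q\<^esub> (l x :: nat) = x"
    and pow_eq: "\<And>i j :: nat. g [^]\<^bsub>Q\<^esub> i = g [^]\<^bsub>Q\<^esub> j \<longleftrightarrow> [int i = int j] (mod int ((p + 1) * (p - 1)))"
    using Q.ex_discrete_log[OF fin_Q] unfolding card_Q n by metis
  define ind where "ind = (\<lambda>x. int (l (h x)))"
  have pow_ind: "g [^]\<^bsub>Q\<^esub> l (h x) = h x" if "x \<in> R" "\<not> rdvd (of_nat p) x" for x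
    using l h_closed h_0 that by simp
  have weaken: "[a = b] (mod int (p + 1))" if "[a = b] (mod int ((p + 1) * (p - 1)))" for a b
    using that by (metis cong_modulus_mult of_nat_mult)
  have h_pow: "h (x ^ k) = h x [^]\<^bsub>Q\<^esub> k" if "x \<in> R" for x k
  proof (induction k)
    case (Suc k)
    have "h (x ^ Suc k) = h (x ^ k * x)" by (simp add: mult.commute)
    also have "\<dots> = h x [^]\<^bsub>Q\<^esub> Suc k" using that Suc by (subst h_mult) auto
    finally show ?case .
  qed (simp add: h_1)
  have prime: "rdvd (of_nat p) x \<or> rdvd (of_nat p) y" if "x \<in> R" "y \<in> R" "rdvd (of_nat p) (x * y)" for x y
    using Q.integral[of "h x" "h y"] h_mult[of x y] h_0 h_closed that by auto
  have ind_mult: "[ind (x * y) = ind x + ind y] (mod int (p + 1))"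
    if "x \<in> R" "y \<in> R" "\<not> rdvd (of_nat p) x" "\<not> rdvd (of_nat p) y" for x y
  proof -
    have "\<not> rdvd (of_nat p) (x * y)" using prime that by blast
    hence "g [^]\<^bsub>Q\<^esub> l (h (x * y)) = h x \<otimes>\<^bsub>Q\<^esub> h y" using pow_ind[of "x * y"] that h_mult by auto
    also have "\<dots> = g [^]\<^bsub>Q\<^esub> (l (h x) + l (h y))"
      using pow_ind that g by (simp flip: Q.nat_pow_mult)
    finally show ?thesis unfolding pow_eq by (intro weaken) (simp add: ind_def)
  qed
  have ind_cong: "[ind x = ind y] (mod int (p + 1))"
    if "x \<in> R" "y \<in> R" "rdvd (of_nat p) (x - y)" for x y
  proof -
    have "h x = h y" using h_eq that by blast
    thus ?thesis by (simp add: ind_def)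
  qed
  have not_dvd_int: "rdvd (of_nat p) (of_int c) \<longleftrightarrow> int p dvd c" for c
    using int_mult_dvd[of c 0 "int p"] by (simp add: rdvd_def)
  \<comment> \<open>By Fermat the image of c has order dividing p - 1, so its logarithm times p - 1
    is a multiple of (p + 1)(p - 1).\<close>
  have ind_int: "int (p + 1) dvd ind (of_int c)" if c: "\<not> int p dvd c" for c
  proof -
    have "[c ^ (p - 1) = 1] (mod int p)"
    proof -
      have "Factorial_Ring.prime (int p)" using p by simp
      hence "coprime (int p) c" using c by (rule prime_imp_coprime)
      hence "coprime c (int p)" by (simp add: coprime_commute)
      moreover have "residues (int p)" using p2 by (intro residues.intro) simp
      ultimately have "[c ^ totient p = 1] (mod int p)" using residues.euler_theorem[of "int p" c] by simp
      thus ?thesis using p by (simp add: totient_prime)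
    qed
    hence "rdvd (of_nat p) (of_int (c ^ (p - 1) - 1))" unfolding not_dvd_int by (simp add: cong_iff_dvd_diff)
    hence "h (of_int c ^ (p - 1)) = h 1" using h_eq[of "of_int c ^ (p - 1)" 1] by auto
    hence "h (of_int c) [^]\<^bsub>Q\<^esub> (p - 1) = \<one>\<^bsub>Q\<^esub>" by (simp add: h_pow h_1)
    moreover have "h (of_int c) = g [^]\<^bsub>Q\<^esub> l (h (of_int c))" using pow_ind c not_dvd_int by simp
    ultimately have "g [^]\<^bsub>Q\<^esub> (l (h (of_int c)) * (p - 1)) = g [^]\<^bsub>Q\<^esub> (0::nat)"
      using g by (metis DiffD1 Q.nat_pow_0 Q.nat_pow_pow)
    hence "int ((p + 1) * (p - 1)) dvd int (l (h (of_int c)) * (p - 1))"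
      unfolding pow_eq by (simp only: of_nat_0 cong_0_iff)
    hence "(p + 1) * (p - 1) dvd l (h (of_int c)) * (p - 1)" by (simp only: of_nat_dvd_iff)
    hence "p + 1 dvd l (h (of_int c))" using p2 by (subst (asm) dvd_times_right_cancel_iff) auto
    thus ?thesis unfolding ind_def by (simp only: of_nat_dvd_iff)
  qed
  have ind_0: "\<exists>c. rdvd (of_nat p) (x - of_int c)"
    if x: "x \<in> R" "\<not> rdvd (of_nat p) x" and "[ind x = 0] (mod int (p + 1))" for x
  proof -
    \<comment> \<open>\<open>K\<close> holds the powers with exponent divisible by p + 1, at most p
      - 1 elements. The nonzero residues of rational integers are p - 1 distinct elements of
      \<open>K\<close>, so they exhaust it.\<close>
    define K where "K = (\<lambda>k. g [^]\<^bsub>Q\<^esub> ((p + 1) * k)) ` {0..<p - 1}"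
    have inK: "h y \<in> K" if y: "y \<in> R" "\<not> rdvd (of_nat p) y" "int (p + 1) dvd ind y" for y
    proof -
      have "p + 1 dvd l (h y)" using y(3) unfolding ind_def by (simp only: of_nat_dvd_iff)
      then obtain k where k: "l (h y) = (p + 1) * k" by (rule dvdE)
      have "[k mod (p - 1) = k] (mod (p - 1))" by simp
      hence "[(p + 1) * (k mod (p - 1)) = (p + 1) * k] (mod (p + 1) * (p - 1))"
        by (metis cong_def mult_mod_right)
      hence "g [^]\<^bsub>Q\<^esub> ((p + 1) * (k mod (p - 1))) = g [^]\<^bsub>Q\<^esub> ((p + 1) * k)"
        unfolding pow_eq cong_int_iff .
      moreover have "k mod (p - 1) \<in> {0..<p - 1}" using p2 by simp
      ultimately show ?thesis using pow_ind[OF y(1,2)] unfolding k K_def by (metis image_eqI)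
    qed
    have "inj_on (\<lambda>c. h (of_int c)) {1..<int p}"
    proof (rule inj_onI)
      fix c d assume cd: "c \<in> {1..<int p}" "d \<in> {1..<int p}" "h (of_int c) = h (of_int d)"
      hence "rdvd (of_nat p) (of_int (c - d))" using h_eq[of "of_int c" "of_int d"] by auto
      hence "int p dvd c - d" by (simp only: not_dvd_int)
      hence "c mod int p = d mod int p" by (simp add: mod_eq_dvd_iff)
      thus "c = d" using cd by simp
    qed
    hence "card ((\<lambda>c. h (of_int c)) ` {1..<int p}) = p - 1" by (simp add: card_image)
    moreover have "card K \<le> p - 1" unfolding K_def using card_image_le[of "{0..<p - 1}"] by simp
    moreover have "(\<lambda>c. h (of_int c)) ` {1..<int p} \<subseteq> K"
    proof clarify
      fix c assume "c \<in> {1..<int p}"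
      hence "\<not> int p dvd c" by (auto dest: zdvd_imp_le)
      thus "h (of_int c) \<in> K" using ind_int not_dvd_int by (intro inK) auto
    qed
    moreover have "finite K" by (simp add: K_def)
    ultimately have K_eq: "(\<lambda>c. h (of_int c)) ` {1..<int p} = K" by (intro card_seteq) simp_all
    have "h x \<in> K" using inK[OF x] that(3) by (simp only: cong_0_iff)
    then obtain c where "h x = h (of_int c)" unfolding K_eq[symmetric] by blast
    thus ?thesis using h_eq[of x "of_int c"] x by auto
  qed
  show ?thesis
  proof (rule that[of ind], unfold_locales)
    obtain \<gamma> where \<gamma>: "\<gamma> \<in> R" "h \<gamma> = g" using g carrier_Q by auto
    hence "\<not> rdvd (of_nat p) \<gamma>" using h_0 g by auto
    moreover from this have "g [^]\<^bsub>Q\<^esub> l (h \<gamma>) = g [^]\<^bsub>Q\<^esub> (1::nat)" using pow_ind[of \<gamma>] \<gamma> g by simp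
    hence "[ind \<gamma> = 1] (mod int (p + 1))" unfolding pow_eq by (intro weaken) (simp add: ind_def)
    ultimately show "\<exists>\<gamma>\<in>R. \<not> rdvd (of_nat p) \<gamma> \<and> [ind \<gamma> = 1] (mod int (p + 1))" using \<gamma> by blast
    fix x assume x: "x \<in> R" "\<not> rdvd (of_nat p) x"
    show "[ind x = 0] (mod int (p + 1)) \<longleftrightarrow> (\<exists>c. rdvd (of_nat p) (x - of_int c))"
    proof
      assume "\<exists>c. rdvd (of_nat p) (x - of_int c)"
      then obtain c where c: "rdvd (of_nat p) (x - of_int c)" by blast
      have "\<not> int p dvd c"
      proof
        assume "int p dvd c"
        hence "rdvd (of_nat p) ((x - of_int c) + of_int c)" using c not_dvd_int by (intro rdvd_add) auto
        thus False using x by simp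
      qed
      hence "[ind (of_int c) = 0] (mod int (p + 1))" using ind_int by (simp only: cong_0_iff)
      thus "[ind x = 0] (mod int (p + 1))" using ind_cong[OF x(1) _ c] cong_trans by blast
    qed (use ind_0 x in blast)
  qed (use p2 prime ind_mult ind_cong in auto)
qed

subsection \<open>Integral closures and ideal classes\<close>

text \<open>Coprimality forces every power of b to divide c, which is impossible for a non-unit. It
  serves for a fraction a/b whose powers have the common denominator c.\<close>

lemma rat_integral_if_powers_bounded_denominator:
  fixes a b c :: int
  assumes "coprime a b" "c \<noteq> 0" "\<And>j. b ^ j dvd c * a ^ j"
  shows "is_unit b"
proof (rule ccontr)
  assume nu: "\<not> is_unit b"
  have b0: "b \<noteq> 0" using assms(2) assms(3)[of 1] assms(1) nu by auto
  hence b2: "\<bar>b\<bar> \<ge> 2" using nu by (auto simp: abs_if)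
  \<comment> \<open>The exponent |c| suffices because 2^j > j.\<close>
  define j where "j = nat \<bar>c\<bar>"
  have "coprime (b ^ j) (a ^ j)" using assms(1) by (simp add: coprime_commute)
  hence "b ^ j dvd c" using assms(3)[of j] by (simp add: coprime_dvd_mult_left_iff)
  hence "\<bar>b ^ j\<bar> \<le> \<bar>c\<bar>" using assms(2) by (rule dvd_imp_le_int[rotated])
  moreover have "2 ^ j \<le> \<bar>b\<bar> ^ j" using b2 by (intro power_mono) auto
  moreover have "int j < 2 ^ j" using of_nat_less_two_power[of j, where ?'a = int] by simp
  ultimately show False by (simp add: power_abs j_def)
qed

text \<open>By coprimality b^2 divides d, so squarefreeness makes b a unit. Later a/b is the
  coefficient of sqrt(d) in 2x for an integral x.\<close>

lemma squarefree_rat_square: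
  fixes a b d M :: int
  assumes "squarefree d" "coprime a b" "d * a\<^sup>2 = M * b\<^sup>2"
  shows "is_unit b"
proof -
  have "b\<^sup>2 dvd d * a\<^sup>2" by (simp add: assms(3))
  moreover have "coprime (b\<^sup>2) (a\<^sup>2)" using assms(2) by (simp add: coprime_commute)
  ultimately have "b\<^sup>2 dvd d" by (simp add: coprime_dvd_mult_left_iff)
  thus ?thesis using assms(1) by (simp add: squarefree_def)
qed

lemma csqrt_neg:
  assumes "d < 0"
  shows "csqrt (of_int d) = \<i> * of_real (sqrt (real_of_int (- d)))"
  using assms by (subst csqrt_of_real_nonpos) auto

text \<open>The minimal polynomial is X^2 - X + (1 - d)/4 or X^2 - d; for d = 1 modulo 4 the
  constant (1 - d)/4 equals \<open>- (d div 4)\<close>.\<close>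

lemma imag_quad_omega:
  assumes "d < 0"
  shows "imag_quad (omega d) (if d mod 4 = 1 then 1 else 0) (if d mod 4 = 1 then - (d div 4) else - d)"
proof
  have "sqrt (real_of_int (- d)) > 0" using assms by simp
  thus "Im (omega d) > 0" unfolding omega_def csqrt_neg[OF assms] by simp
  have r: "csqrt (of_int d) * csqrt (of_int d) = of_int d" by (simp flip: power2_eq_square)
  show "omega d * omega d = of_int (if d mod 4 = 1 then 1 else 0) * omega d - of_int (if d mod 4 = 1 then - (d div 4) else - d)"
  proof (cases "d mod 4 = 1")
    case True
    hence "d = 4 * (d div 4) + 1" using mult_div_mod_eq[of 4 d] by simp
    then obtain k where k: "d div 4 = k" "d = 4 * k + 1" by blast
    have "omega d * omega d = (1 + 2 * csqrt (of_int d) + of_int d) / 4"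
      unfolding omega_def using True by (simp add: field_simps r)
    also have "\<dots> = omega d + of_int k" unfolding omega_def using True by (simp add: k(2) field_simps)
    finally show ?thesis using True k by simp
  qed (simp add: omega_def r)
qed

section \<open>Integrality through traces and norms\<close>

context imag_quad
begin

lemma ex_char_poly:
  assumes "x \<in> R" shows "\<exists>T N :: int. poly [:of_int N, of_int T, 1:] x = 0"
proof -
  obtain a b where x: "x = of_int a + of_int b * w" using assms by (elim R_E)
  define T where "T = - (2 * a + t * b)"
  define N where "N = a\<^sup>2 + t * a * b + m * b\<^sup>2"
  have "poly [:of_int N, of_int T, 1:] x = of_int (b\<^sup>2) * (w * w - of_int t * w + of_int m)"
    by (simp add: x N_def T_def algebra_simps power2_eq_square)
  also have "\<dots> = 0" by (simp add: w_sq)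
  finally show ?thesis by blast
qed

text \<open>With n the degree of \<open>f\<close>, the factor q^n clears the denominators of x^j for
  j < n. The monic equation expresses every higher power by lower ones with coefficients in
  \<open>R\<close>, so the same factor serves for all j.\<close>

lemma bounded_denominator:
  fixes x :: complex and f :: "complex poly" and q :: int
  assumes q: "q \<noteq> 0" "of_int q * x \<in> R"
    and f: "lead_coeff f = 1" "\<And>i. coeff f i \<in> R" "poly f x = 0"
  shows "\<exists>Q::int. Q \<noteq> 0 \<and> (\<forall>j. of_int Q * x ^ j \<in> R)"
proof -
  define n where "n = degree f"
  define Q where "Q = q ^ n"
  have "x ^ n + (\<Sum>i<n. coeff f i * x ^ i) = 0"
    using f(1,3) unfolding poly_altdef n_def by (simp add: lessThan_Suc_atMost[symmetric] add.commute)
  hence xn: "x ^ n = - (\<Sum>i<n. coeff f i * x ^ i)" by (simp add: eq_neg_iff_add_eq_0)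
  have "of_int Q * x ^ j \<in> R" for j
  proof (induction j rule: less_induct)
    case (less j)
    show ?case
    proof (cases "j < n")
      case True
      have "of_int Q * x ^ j = of_int (q ^ (n - j)) * (of_int q * x) ^ j"
        using True by (simp add: Q_def power_mult_distrib flip: power_add)
      also have "\<dots> \<in> R" by (intro R_mult R_power q R_int)
      finally show ?thesis .
    next
      case False
      have "of_int Q * x ^ j = of_int Q * x ^ (j - n) * x ^ n" using False by (simp flip: power_add)
      also have "\<dots> = - (\<Sum>i<n. coeff f i * (of_int Q * x ^ (i + j - n)))"
      proof -
        have "x ^ (j - n) * x ^ i = x ^ (i + j - n)" for i using False by (simp add: add.commute flip: power_add)
        thus ?thesis unfolding xn by (simp add: sum_distrib_left mult_ac)
      qed
      also have "\<dots> \<in> R" using False by (intro R_minus R_sum R_mult f(2) less.IH) auto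
      finally show ?thesis .
    qed
  qed
  moreover have "Q \<noteq> 0" using q by (simp add: Q_def)
  ultimately show ?thesis by blast
qed

text \<open>The powers of |x|^2 are the squared absolute values of the powers of x, so they share
  the denominator Q^2. A rational number with this property is an integer.\<close>

lemma norm_sq_integral:
  fixes x :: complex and Q :: int
  assumes "Q \<noteq> 0" "\<And>j. of_int Q * x ^ j \<in> R"
  shows "\<exists>N::int. (cmod x)\<^sup>2 = of_int N"
proof -
  have 1: "\<exists>k::int. of_int (Q\<^sup>2) * (cmod x)\<^sup>2 ^ j = (of_int k :: real)" for j
  proof -
    obtain k where "(cmod (of_int Q * x ^ j))\<^sup>2 = real k" using norm_sq_int[OF assms(2)] by blast
    hence "of_int (Q\<^sup>2) * (cmod x)\<^sup>2 ^ j = of_int (int k)"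
      by (simp add: norm_mult norm_power power_mult_distrib power2_abs flip: power_mult) (simp add: mult.commute)
    thus ?thesis by blast
  qed
  obtain k where k: "of_int (Q\<^sup>2) * (cmod x)\<^sup>2 = (of_int k :: real)" using 1[of 1] by auto
  hence "(cmod x)\<^sup>2 = of_rat (Rat.Fract k (Q\<^sup>2))"
    using assms(1) by (simp add: of_rat_rat field_simps)
  then obtain y where y: "(cmod x)\<^sup>2 = of_rat y" by blast
  obtain a b where ab: "quotient_of y = (a, b)" by (cases "quotient_of y")
  have b: "b > 0" "coprime a b" using quotient_of_denom_pos[OF ab] quotient_of_coprime[OF ab] by auto
  have y': "(cmod x)\<^sup>2 = of_int a / of_int b" using y quotient_of_div[OF ab] by (simp add: of_rat_divide)
  have "is_unit b"
  proof (rule rat_integral_if_powers_bounded_denominator)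
    show "coprime a b" "Q\<^sup>2 \<noteq> 0" using b assms by auto
    fix j
    obtain k where "of_int (Q\<^sup>2) * (cmod x)\<^sup>2 ^ j = (of_int k :: real)" using 1 by blast
    hence "real_of_int (Q\<^sup>2 * a ^ j) = real_of_int (k * b ^ j)"
      unfolding y' using b by (simp add: power_divide field_simps)
    hence "Q\<^sup>2 * a ^ j = k * b ^ j" by (simp only: of_int_eq_iff)
    thus "b ^ j dvd Q\<^sup>2 * a ^ j" by simp
  qed
  hence "b = 1" using b by simp
  thus ?thesis using y' by auto
qed

text \<open>The norm criterion is applied to x and to x + 1, whose powers have the same common
  denominator by the binomial theorem; |x + 1|^2 - |x|^2 - 1 is the trace.\<close>

lemma trace_norm_integral:
  fixes x :: complex and Q :: int
  assumes "Q \<noteq> 0" "\<And>j. of_int Q * x ^ j \<in> R"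
  shows "\<exists>T N::int. 2 * Re x = of_int T \<and> (cmod x)\<^sup>2 = of_int N"
proof -
  have "of_int Q * (x + 1) ^ j \<in> R" for j
  proof -
    have "of_int Q * (x + 1) ^ j = (\<Sum>i\<le>j. of_nat (j choose i) * (of_int Q * x ^ i))"
      by (simp add: binomial_ring sum_distrib_left mult_ac)
    also have "\<dots> \<in> R" by (intro R_sum R_mult assms R_nat)
    finally show ?thesis .
  qed
  then obtain M :: int where "(cmod (x + 1))\<^sup>2 = of_int M" using norm_sq_integral assms(1) by blast
  moreover obtain N :: int where "(cmod x)\<^sup>2 = of_int N" using norm_sq_integral assms by blast
  moreover have "(cmod (x + 1))\<^sup>2 = (cmod x)\<^sup>2 + 2 * Re x + 1"
    unfolding cmod_power2 by (simp add: power2_eq_square algebra_simps)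
  ultimately have "2 * Re x = of_int (M - N - 1)" "(cmod x)\<^sup>2 = of_int N" by simp_all
  thus ?thesis by blast
qed

end

text \<open>Write 2x = T + r sqrt(d) with r rational. Integrality of trace and norm makes T an
  integer and T^2 - d r^2 a multiple of 4; squarefreeness makes r an integer, and the congruence
  modulo 4 settles the parities.\<close>

lemma integral_mem_quad_order:
  fixes d q :: int and x :: complex
  assumes d: "d < 0" "squarefree d"
    and q: "q \<noteq> 0" "of_int q * x \<in> quad_order (omega d)"
    and f: "lead_coeff f = 1" "\<And>i. coeff f i \<in> quad_order (omega d)" "poly f x = 0"
  shows "x \<in> quad_order (omega d)"
proof -
  interpret imag_quad "omega d" "if d mod 4 = 1 then 1 else 0" "if d mod 4 = 1 then - (d div 4) else - d"
    by (rule imag_quad_omega[OF d(1)])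
  define s where "s = sqrt (real_of_int (- d))"
  have s: "s > 0" "s\<^sup>2 = - real_of_int d" using d by (simp_all add: s_def)
  have r: "csqrt (of_int d) = \<i> * of_real s" unfolding s_def by (rule csqrt_neg[OF d(1)])
  obtain T N :: int where TN: "2 * Re x = of_int T" "(cmod x)\<^sup>2 = of_int N"
    using bounded_denominator[OF q f] trace_norm_integral by blast
  obtain u v where uv: "of_int q * x = of_int u + of_int v * omega d" using q(2) by (elim R_E)
  hence "Im (of_int q * x) = Im (of_int u + of_int v * omega d)" by simp
  hence "real_of_int q * Im x = v * Im (omega d)" by simp
  moreover have "Im (omega d) = (if d mod 4 = 1 then s / 2 else s)" by (simp add: omega_def r)
  ultimately have "2 * Im x = of_int (if d mod 4 = 1 then v else 2 * v) / of_int q * s"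
    using q(1) by (auto simp: field_simps)
  then obtain v' :: int where v': "2 * Im x = of_int v' / of_int q * s" by blast
  define y where "y = Rat.Fract v' q"
  obtain a b where ab: "quotient_of y = (a, b)" by (cases "quotient_of y")
  have b: "b > 0" "coprime a b" using quotient_of_denom_pos[OF ab] quotient_of_coprime[OF ab] by auto
  have "real_of_int v' / real_of_int q = of_rat y" by (simp add: y_def of_rat_rat q)
  also have "\<dots> = of_int a / of_int b" using quotient_of_div[OF ab] by (simp add: of_rat_divide)
  finally have Im: "2 * Im x = of_int a / of_int b * s" using v' by simp
  have "4 * (cmod x)\<^sup>2 = (2 * Re x)\<^sup>2 + (2 * Im x)\<^sup>2" unfolding cmod_power2 by (simp add: power2_eq_square)
  hence eq: "4 * real_of_int N = (of_int T)\<^sup>2 - (of_int a / of_int b)\<^sup>2 * of_int d"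
    unfolding TN Im power_mult_distrib s(2) by simp
  hence "real_of_int (d * a\<^sup>2) = real_of_int ((T\<^sup>2 - 4 * N) * b\<^sup>2)" using b by (simp add: field_simps)
  hence "d * a\<^sup>2 = (T\<^sup>2 - 4 * N) * b\<^sup>2" by (simp only: of_int_eq_iff)
  hence "is_unit b" by (rule squarefree_rat_square[OF d(2) b(2)])
  hence "b = 1" using b by simp
  with eq have "real_of_int (4 * N) = real_of_int (T\<^sup>2 - d * a\<^sup>2)" by simp
  hence N4: "4 * N = T\<^sup>2 - d * a\<^sup>2" by (simp only: of_int_eq_iff)
  have x: "x = (of_int T + of_int a * csqrt (of_int d)) / 2"
    using TN(1) Im \<open>b = 1\<close> by (simp add: complex_eq_iff r)
  have par: "(T\<^sup>2 - d * a\<^sup>2) mod 4 = 0" unfolding N4[symmetric] by simp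
  have sq: "(z\<^sup>2) mod 4 = (if even z then 0 else 1)" for z :: int
  proof (cases "even z")
    case True
    thus ?thesis by (auto elim!: evenE simp: power2_eq_square)
  next
    case False
    then obtain k where "z = 2 * k + 1" by (elim oddE)
    hence "z\<^sup>2 = 1 + 4 * (k * k + k)" by (simp add: power2_eq_square algebra_simps)
    thus ?thesis using False by (simp only: mod_mult_self2) simp
  qed
  \<comment> \<open>Squares are 0 or 1 modulo 4, so the divisibility depends only on the parities of
    T and a and on d modulo 4.\<close>
  have par': "((if even T then 0 else 1) - d mod 4 * (if even a then 0 else 1)) mod 4 = 0"
  proof -
    have "(T\<^sup>2 mod 4 - d mod 4 * (a\<^sup>2 mod 4)) mod 4 = (T\<^sup>2 - d * a\<^sup>2) mod 4"
      by (rule mod_diff_cong) (simp_all add: mod_mult_eq)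
    thus ?thesis using par unfolding sq[symmetric] by simp
  qed
  show ?thesis
  proof (cases "d mod 4 = 1")
    case True
    with par' have "even (T - a)" by (auto split: if_splits)
    then obtain k where "T = a + 2 * k" by (metis diff_eq_eq evenE add.commute)
    hence "x = of_int k + of_int a * omega d" using True by (simp add: x omega_def field_simps)
    thus ?thesis by auto
  next
    case False
    \<comment> \<open>A multiple of 4 is not squarefree; the remaining residues 2 and 3 force both T
      and a to be even.\<close>
    have "d mod 4 \<noteq> 0"
    proof
      assume "d mod 4 = 0"
      hence "2\<^sup>2 dvd d" by auto
      hence "is_unit (2::int)" using d(2) unfolding squarefree_def by blast
      thus False by simp
    qed
    with False have "d mod 4 = 2 \<or> d mod 4 = 3" by presburger
    with par' have "even T \<and> even a" by (auto split: if_splits)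
    then obtain k l where "T = 2 * k" "a = 2 * l" by (auto elim!: evenE)
    hence "x = of_int k + of_int l * omega d" using False by (simp add: x omega_def)
    thus ?thesis by auto
  qed
qed

text \<open>With b \<noteq> 0 the norm form exceeds 1: it is at least |d| \<ge> 4 unless d is 1
  modulo 4, and in that case d \<le> -7 and completing the square gives at least 7/4.\<close>

lemma units_quad_order:
  assumes "d < - 3" "squarefree d" "x \<in> quad_order (omega d)" "cmod x = 1"
  shows "x = 1 \<or> x = - 1"
proof -
  have d0: "d < 0" using assms by simp
  interpret imag_quad "omega d" "if d mod 4 = 1 then 1 else 0" "if d mod 4 = 1 then - (d div 4) else - d"
    by (rule imag_quad_omega[OF d0])
  obtain a b where x: "x = of_int a + of_int b * omega d" using assms(3) by (elim R_E)
  have "real_of_int (a\<^sup>2 + (if d mod 4 = 1 then 1 else 0) * a * b + (if d mod 4 = 1 then - (d div 4) else - d) * b\<^sup>2) = real_of_int 1"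
    unfolding norm_pair[symmetric] x[symmetric] assms(4) by simp
  hence eq: "a\<^sup>2 + (if d mod 4 = 1 then 1 else 0) * a * b + (if d mod 4 = 1 then - (d div 4) else - d) * b\<^sup>2 = 1"
    by (simp only: of_int_eq_iff)
  have "b = 0"
  proof (rule ccontr)
    assume "b \<noteq> 0"
    hence b: "b\<^sup>2 \<ge> 1" by (smt (verit) zero_less_power2)
    show False
    proof (cases "d mod 4 = 1")
      case True
      hence "d div 4 \<le> -2" using assms(1) by presburger
      hence "2 * b\<^sup>2 \<le> - (d div 4) * b\<^sup>2" by (intro mult_right_mono) auto
      hence "a\<^sup>2 + a * b + 2 * b\<^sup>2 \<le> 1" using eq True by simp
      moreover define S where "S = (2 * a + b)\<^sup>2"
      moreover have "4 * (a\<^sup>2 + a * b + 2 * b\<^sup>2) = S + 7 * b\<^sup>2" by (simp add: S_def power2_eq_square algebra_simps)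
      moreover have "S \<ge> 0" by (simp add: S_def)
      ultimately show False using b by simp
    next
      case False
      have "4 * b\<^sup>2 \<le> (- d) * b\<^sup>2" using assms(1) by (intro mult_right_mono) auto
      moreover have "a\<^sup>2 \<ge> 0" by simp
      moreover have "a\<^sup>2 + (- d) * b\<^sup>2 = 1" using eq False by simp
      ultimately show False using b by linarith
    qed
  qed
  with eq have "a\<^sup>2 = 1" by simp
  hence "a = 1 \<or> a = - 1" by (simp add: power2_eq_1_iff)
  thus ?thesis using x \<open>b = 0\<close> by auto
qed

text \<open>The order is Z + pR. This is the bridge between membership in it and the kernel of the
  index.\<close>

lemma (in imag_quad) in_suborder_iff:
  assumes "x \<in> R"
  shows "x \<in> quad_order (of_nat p * w) \<longleftrightarrow> (\<exists>c. rdvd (of_nat p) (x - of_int c))"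
proof
  assume "x \<in> quad_order (of_nat p * w)"
  then obtain a b where "x = of_int a + of_int b * (of_nat p * w)" by (auto simp: quad_order_def)
  hence "x - of_int a = of_nat p * (of_int b * w)" by simp
  moreover have "of_int b * w \<in> R" by (intro R_mult R_int R_w)
  ultimately show "\<exists>c. rdvd (of_nat p) (x - of_int c)" unfolding rdvd_def by blast
next
  assume "\<exists>c. rdvd (of_nat p) (x - of_int c)"
  then obtain c a b where "x - of_int c = of_nat p * (of_int a + of_int b * w)"
    by (auto simp: rdvd_def elim!: R_E)
  hence "x = of_int (c + int p * a) + of_int b * (of_nat p * w)" by (simp add: algebra_simps)
  thus "x \<in> quad_order (of_nat p * w)" unfolding quad_order_def by blast
qed

lemma (in imag_quad) suborder_subset: "quad_order (of_nat p * w) \<subseteq> R"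
proof
  fix x assume "x \<in> quad_order (of_nat p * w)"
  then obtain a b where "x = of_int a + of_int b * (of_nat p * w)" by (auto simp: quad_order_def)
  thus "x \<in> R" by (simp only:) (intro R_add R_mult R_int R_nat R_w)
qed

text \<open>An element integral over the order is integral over \<open>R\<close>, and a rational
  denominator for it can be found, so it lies in \<open>R\<close>. Conversely x = (p x) / p is a
  quotient of elements of the order, and its characteristic polynomial has integer
  coefficients.\<close>

lemma integral_closure_quad_order:
  fixes d :: int and p :: nat
  assumes d: "d < 0" "squarefree d" and p: "p > 0"
  shows "integral_closure (quad_order (of_nat p * omega d)) = quad_order (omega d)"
proof -
  interpret imag_quad "omega d" "if d mod 4 = 1 then 1 else 0" "if d mod 4 = 1 then - (d div 4) else - d"
    by (rule imag_quad_omega[OF d(1)])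
  define S where "S = quad_order (of_nat p * omega d)"
  have SR: "S \<subseteq> R" unfolding S_def by (rule suborder_subset)
  have int_S: "of_int a \<in> S" for a 
  proof -
    have "of_int a = of_int a + of_int 0 * (of_nat p * omega d)" by simp
    thus ?thesis unfolding S_def quad_order_def by blast
  qed
  show ?thesis unfolding S_def[symmetric]
  proof (intro equalityI subsetI)
    fix x assume "x \<in> integral_closure S"
    then obtain f y z where x: "x = y / z" "y \<in> S" "z \<in> S" "z \<noteq> 0" and f: "lead_coeff f = 1" "\<And>i. coeff f i \<in> S" "poly f x = 0"
      unfolding integral_closure_def fraction_field_def by blast
    have yz: "y \<in> R" "z \<in> R" using x SR by blast+
    \<comment> \<open>Multiplying by the conjugate makes the denominator the rational integer
      |z|^2.\<close>
    obtain q where q: "(cmod z)\<^sup>2 = real q" using norm_sq_int[of z] yz by blast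
    hence "q \<noteq> 0" using x(4) by (metis norm_eq_zero of_nat_0 power_eq_0_iff)
    have "z * cnj z = of_int (int q)" unfolding complex_norm_square[symmetric] by (simp flip: of_real_power add: q)
    hence "of_int (int q) * x = (z * x) * cnj z" by (simp add: mult_ac)
    also have "z * x = y" using x by simp
    also have "y * cnj z \<in> R" using yz by (intro R_mult conj_mem)
    finally show "x \<in> R" using f SR \<open>q \<noteq> 0\<close>
      by (intro integral_mem_quad_order[OF d, of "int q" x f]) auto
  next
    fix x assume x: "x \<in> R"
    have "of_nat p * x \<in> S" unfolding S_def
      using x by (subst in_suborder_iff) (auto simp: rdvd_def intro!: exI[of _ 0])
    moreover have "x = (of_nat p * x) / of_int (int p)" "of_int (int p) \<noteq> (0::complex)" using p by simp_all
    ultimately have "x \<in> fraction_field S" unfolding fraction_field_def using int_S by blast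
    moreover obtain T N :: int where "poly [:of_int N, of_int T, 1:] x = 0" using ex_char_poly[OF x] by blast
    moreover have "coeff [:of_int N, of_int T, 1:] i \<in> S" for i
      using int_S[of N] int_S[of T] int_S[of 1] int_S[of 0] by (auto simp: coeff_pCons split: nat.split)
    moreover have "lead_coeff [:of_int N, of_int T, 1::complex:] = 1" by simp
    ultimately show "x \<in> integral_closure S" unfolding integral_closure_def by blast
  qed
qed

text \<open>The rational coordinates of an algebraic integer have a common denominator, which brings
  it under the integrality criterion over \<open>R\<close>. This identifies the ring behind the
  class number with \<open>R\<close>.\<close>

lemma ring_of_integers_quad_field:
  assumes d: "d < 0" "squarefree d"
  shows "ring_of_integers (quad_field d) = quad_order (omega d)"
proof -
  interpret imag_quad "omega d" "if d mod 4 = 1 then 1 else 0" "if d mod 4 = 1 then - (d div 4) else - d"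
    by (rule imag_quad_omega[OF d(1)])
  show ?thesis
  proof (intro equalityI subsetI)
    fix x assume "x \<in> ring_of_integers (quad_field d)"
    then obtain u v f where x: "x = of_rat u + of_rat v * csqrt (of_int d)"
      and f: "lead_coeff f = 1" "\<And>i. coeff f i \<in> \<int>" "poly f x = 0"
      unfolding ring_of_integers_def quad_field_def by (auto elim!: algebraic_int.cases)
    obtain a b where u: "u = Rat.Fract a b" "b > 0" by (cases u)
    obtain k l where v: "v = Rat.Fract k l" "l > 0" by (cases v)
    define r where "r = csqrt (of_int d)"
    have "x = of_int a / of_int b + of_int k / of_int l * r" using u v by (simp add: x r_def of_rat_rat)
    hence "of_int (b * l) * x = of_int (a * l) + of_int (b * k) * r"
      using u(2) v(2) by (simp add: field_simps)
    also have "r = of_int (if d mod 4 = 1 then - 1 else 0) + of_int (if d mod 4 = 1 then 2 else 1) * omega d"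
      by (simp add: omega_def r_def)
    also have "of_int (a * l) + of_int (b * k) * \<dots> \<in> R" by (intro R_add R_mult R_int R_w)
    finally have "of_int (b * l) * x \<in> R" .
    moreover have "coeff f i \<in> R" for i using f(2)[of i] by (metis Ints_cases R_int)
    ultimately show "x \<in> R" using f(1,3) u(2) v(2)
      by (intro integral_mem_quad_order[OF d, of "b * l" x f]) auto
  next
    fix x assume x: "x \<in> R"
    obtain T N :: int where "poly [:of_int N, of_int T, 1:] x = 0" using ex_char_poly[OF x] by blast
    moreover have "coeff [:of_int N, of_int T, 1::complex:] i \<in> \<int>" for i
      by (auto simp: coeff_pCons split: nat.split)
    moreover have "lead_coeff [:of_int N, of_int T, 1::complex:] = 1" by simp
    ultimately have "algebraic_int x" by (blast intro: algebraic_int.intros)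
    moreover obtain a b where ab: "x = of_int a + of_int b * omega d" using x by (elim R_E)
    define r where "r = csqrt (of_int d)"
    have "x \<in> quad_field d"
    proof (cases "d mod 4 = 1")
      case True
      have rat: "of_rat (of_int a + of_int b / 2) = (of_int a + of_int b / 2 :: complex)"
        "of_rat (of_int b / 2) = (of_int b / 2 :: complex)" by (simp_all add: of_rat_add of_rat_divide)
      have "omega d = (1 + r) / 2" using True by (simp add: omega_def r_def)
      hence "x = of_int a + of_int b * ((1 + r) / 2)" using ab by simp
      also have "\<dots> = (of_int a + of_int b / 2) + of_int b / 2 * r"
        by (simp add: distrib_left add_divide_distrib)
      also have "\<dots> = of_rat (of_int a + of_int b / 2) + of_rat (of_int b / 2) * r" unfolding rat ..
      finally show ?thesis unfolding quad_field_def r_def by blast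
    next
      case False
      hence "x = of_int a + of_int b * r" using ab by (simp add: omega_def r_def)
      also have "\<dots> = of_rat (of_int a) + of_rat (of_int b) * r" by simp
      finally show ?thesis unfolding quad_field_def r_def by blast
    qed
    ultimately show "x \<in> ring_of_integers (quad_field d)" unfolding ring_of_integers_def by blast
  qed
qed

section \<open>Class number one and principal ideals\<close>

lemma card_1_quotient_related:
  assumes "card (A // r) = 1" "x \<in> A" "y \<in> A" "(y, y) \<in> r"
  shows "(x, y) \<in> r"
proof -
  obtain C where C: "A // r = {C}" using assms(1) by (rule card_1_singletonE)
  have "r `` {x} \<in> A // r" "r `` {y} \<in> A // r"
    using assms by (auto intro: quotientI)
  hence "r `` {x} = r `` {y}" using C by auto
  \<comment> \<open>Reflexivity at \<open>y\<close> places y in its own image, which is also the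
    image of x.\<close>
  thus ?thesis using assms(4) by auto
qed

text \<open>A nonzero ideal I is in the class of R, so a I = b R. Then b = a i for some i in I, and
  cancelling a gives I = i R.\<close>

lemma (in imag_quad) principal_domain_if_one_class:
  assumes "card (nonzero_ideals (ring_on R) // ideal_class_rel (ring_on R)) = 1"
  shows "principal_domain (ring_on R)"
proof -
  interpret D: domain "ring_on R" by (rule domain_R)
  have principal: "\<exists>a\<in>R. I = PIdl\<^bsub>ring_on R\<^esub> a" if I: "ideal I (ring_on R)" for I
  proof (cases "I = {0}")
    case True
    have "I = PIdl\<^bsub>ring_on R\<^esub> 0" unfolding True by (auto simp: cgenideal_def ring_on_simps)
    thus ?thesis by blast
  next
    case False
    have one: "1 \<in> R - {0}" by simp
    hence "R \<noteq> {0}" by blast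
    hence RI: "R \<in> nonzero_ideals (ring_on R)"
      using D.oneideal unfolding nonzero_ideals_def ring_on_simps by blast
    have "I \<in> nonzero_ideals (ring_on R)" using I False by (simp add: nonzero_ideals_def ring_on_simps)
    moreover have "(R, R) \<in> ideal_class_rel (ring_on R)"
      using RI one unfolding ideal_class_rel_def ring_on_simps by blast
    ultimately have "(I, R) \<in> ideal_class_rel (ring_on R)"
      using card_1_quotient_related[OF assms _ RI] by blast
    then obtain a b where ab: "a \<in> R" "a \<noteq> 0" "b \<in> R" "b \<noteq> 0" "a <#\<^bsub>ring_on R\<^esub> I = b <#\<^bsub>ring_on R\<^esub> R"
      unfolding ideal_class_rel_def ring_on_simps by blast
    have coset: "c <#\<^bsub>ring_on R\<^esub> J = (\<lambda>x. c * x) ` J" for c J by (auto simp: l_coset_def ring_on_simps)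
    have eq: "(\<lambda>x. a * x) ` I = (\<lambda>x. b * x) ` R" using ab(5) unfolding coset .
    have "b * 1 \<in> (\<lambda>x. b * x) ` R" by (rule imageI) simp
    then obtain i where i: "i \<in> I" "b = a * i" unfolding eq[symmetric] by auto
    have "(\<lambda>x. a * x) ` I = (\<lambda>x. a * x) ` ((\<lambda>x. i * x) ` R)" unfolding eq i(2) image_image by (simp add: mult.assoc)
    moreover have "inj (\<lambda>x. a * x)" using ab(2) by (auto simp: inj_on_def)
    ultimately have "I = (\<lambda>x. i * x) ` R" by (simp only: inj_image_eq_iff)
    also have "\<dots> = PIdl\<^bsub>ring_on R\<^esub> i" by (auto simp: cgenideal_def ring_on_simps mult.commute)
    finally show ?thesis using i(1) ideal.Icarr[OF I, of i] by (auto simp: ring_on_simps)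
  qed
  show ?thesis
  proof (intro principal_domain.intro principal_domain_axioms.intro domain_R)
    show "\<exists>a\<in>carrier (ring_on R). I = PIdl\<^bsub>ring_on R\<^esub> a" if "ideal I (ring_on R)" for I
      using principal[OF that] by (simp add: ring_on_simps)
  qed
qed

section \<open>Irreducible elements as prime elements\<close>

context imag_quad_units
begin

lemma irr_imp_ring_irreducible:
  assumes "irr q" shows "ring_irreducible\<^bsub>ring_on R\<^esub> q"
proof -
  interpret D: domain "ring_on R" by (rule domain_R)
  have q: "q \<in> R" "q \<noteq> 0" "q \<notin> {1, -1}" using assms by (auto simp: irr_def)
  have unit: "u \<in> Units (ring_on R)" if "u \<in> {1, -1}" for u
  proof -
    have "u \<in> R" "u * u = 1" using that R_minus[OF R_1] by auto
    thus ?thesis unfolding Units_def ring_on_simps by blast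
  qed
  show ?thesis
  proof (rule D.ring_irreducibleI)
    show "q \<in> carrier (ring_on R) - {\<zero>\<^bsub>ring_on R\<^esub>}" using q by (simp add: ring_on_simps)
    show "q \<notin> Units (ring_on R)"
    proof
      assume "q \<in> Units (ring_on R)"
      then obtain y where "y \<in> R" "q * y = 1" unfolding Units_def ring_on_simps by blast
      thus False using unit_factors[of q y] q by blast
    qed
    show "a \<in> Units (ring_on R) \<or> b \<in> Units (ring_on R)"
      if "a \<in> carrier (ring_on R)" "b \<in> carrier (ring_on R)" "q = a \<otimes>\<^bsub>ring_on R\<^esub> b" for a b
      using that assms unit unfolding irr_def ring_on_simps by blast
  qed
qed

lemma ufd_if_principal_domain:
  assumes "principal_domain (ring_on R)"
  shows "imag_quad_ufd w t m"
proof unfold_locales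
  interpret D: principal_domain "ring_on R" by fact
  fix q x y assume q: "irr q" and xy: "x \<in> R" "y \<in> R" "rdvd q (x * y)"
  have qR: "q \<in> R" "q \<noteq> 0" using q by (auto simp: irr_def)
  have "ring_prime\<^bsub>ring_on R\<^esub> q"
    using D.primeness_condition[of q] irr_imp_ring_irreducible[OF q] qR by (simp add: ring_on_simps)
  hence "primeideal (PIdl\<^bsub>ring_on R\<^esub> q) (ring_on R)"
    using D.primeideal_iff_prime[of q] qR by (simp add: ring_on_simps)
  from primeideal.I_prime[OF this, of x y] xy show "rdvd q x \<or> rdvd q y"
    by (simp add: PIdl_iff[OF qR(1)] ring_on_simps)
qed

end

section \<open>The constant of the order\<close>

lemma (in residue_index) ind_prod:
  assumes "finite I" "\<And>i. i \<in> I \<Longrightarrow> f i \<in> R \<and> \<not> rdvd (of_nat p) (f i)"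
  shows "\<not> rdvd (of_nat p) (prod f I) \<and> [ind (prod f I) = (\<Sum>i\<in>I. ind (f i))] (mod int n)"
  using assms
proof (induction I)
  case empty
  show ?case using ind_int[of 1] not_p_dvd_unit by simp
next
  case (insert j I)
  have R: "f j \<in> R" "prod f I \<in> R" using insert.prems by auto
  have nd: "\<not> rdvd (of_nat p) (f j)" "\<not> rdvd (of_nat p) (prod f I)" using insert by auto
  have "[ind (f j * prod f I) = ind (f j) + ind (prod f I)] (mod int n)" using R nd by (rule ind_mult)
  moreover have "[ind (f j) + ind (prod f I) = ind (f j) + (\<Sum>i\<in>I. ind (f i))] (mod int n)"
    using insert by (intro cong_add cong_refl) auto
  ultimately have "[ind (f j * prod f I) = ind (f j) + (\<Sum>i\<in>I. ind (f i))] (mod int n)"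
    by (rule cong_trans)
  moreover have "\<not> rdvd (of_nat p) (f j * prod f I)" using p_prime R nd by blast
  ultimately show ?case using insert.hyps by simp
qed

text \<open>Pigeonhole: the n + 1 partial sums, including the empty one, take at most n values
  modulo n, and two equal ones bound a block with sum 0.\<close>

lemma zero_sum_block:
  fixes f :: "nat \<Rightarrow> int" and n :: nat
  assumes "n > 0"
  shows "\<exists>k l. k < l \<and> l \<le> n \<and> [(\<Sum>i\<in>{k..<l}. f i) = 0] (mod int n)"
proof -
  define s where "s = (\<lambda>k. (\<Sum>i<k. f i) mod int n)"
  have "s ` {0..n} \<subseteq> {0..<int n}" using assms by (auto simp: s_def)
  hence "card (s ` {0..n}) \<le> n" using card_mono[of "{0..<int n}" "s ` {0..n}"] by simp
  hence "card (s ` {0..n}) < card {0..n}" by simp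
  hence "\<not> inj_on s {0..n}" by (rule pigeonhole)
  then obtain k l where kl: "k < l" "l \<le> n" "s k = s l"
    unfolding inj_on_def by (metis atLeastAtMost_iff linorder_neqE_nat)
  have "{..<l} = {..<k} \<union> {k..<l}" using kl by auto
  hence "(\<Sum>i<l. f i) = (\<Sum>i\<in>{..<k} \<union> {k..<l}. f i)" by simp
  also have "\<dots> = (\<Sum>i<k. f i) + (\<Sum>i\<in>{k..<l}. f i)" by (rule sum.union_disjoint) auto
  finally have "(\<Sum>i<l. f i) = (\<Sum>i<k. f i) + (\<Sum>i\<in>{k..<l}. f i)" .
  moreover have "int n dvd (\<Sum>i<l. f i) - (\<Sum>i<k. f i)" using kl(3)[symmetric] unfolding s_def by (simp add: mod_eq_dvd_iff)
  ultimately have "[(\<Sum>i\<in>{k..<l}. f i) = 0] (mod int n)" by (simp add: cong_0_iff)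
  thus ?thesis using kl by blast
qed

lemma (in residue_index) D_const_suborder:
  "D_const (ring_on R) (quad_order (of_nat p * w)) = enat n"
proof -
  define S where "S = quad_order (of_nat p * w)"
  have in_S: "x \<in> S \<longleftrightarrow> [ind x = 0] (mod int n)" if "x \<in> R" "\<not> rdvd (of_nat p) x" for x
    unfolding S_def using that in_suborder_iff ind_eq_0_iff by simp
  have finprod: "(\<Otimes>\<^bsub>ring_on R\<^esub>i\<in>I. xs ! i) = (\<Prod>i\<in>I. xs ! i)"
    if "I \<subseteq> {..<length xs}" "set xs \<subseteq> R" for I xs
    using that finite_subset[OF that(1)] by (intro finprod_ring_on domain_R) (auto simp: subset_iff)
  define good where "good = {k. \<forall>xs. length xs = k \<and> R_product (ring_on R) xs \<longrightarrow> has_subproduct_in (ring_on R) S xs}"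
  have upper: "n \<in> good"
    unfolding good_def
  proof (intro CollectI allI impI)
    fix xs assume "length xs = n \<and> R_product (ring_on R) xs"
    hence xs: "length xs = n" "set xs \<subseteq> R" by (auto simp: R_product_def ring_on_simps)
    show "has_subproduct_in (ring_on R) S xs"
    \<comment> \<open>A factor divisible by p lies in the order by itself; otherwise all factors
      have an index, and a block of indices with sum 0 gives the subproduct.\<close>
    proof (cases "\<exists>i<n. rdvd (of_nat p) (xs ! i)")
      case True
      then obtain i where i: "i < n" "rdvd (of_nat p) (xs ! i)" by blast
      have "xs ! i \<in> S" unfolding S_def
        using xs i by (subst in_suborder_iff) (auto simp: subset_iff intro!: exI[of _ 0])
      thus ?thesis unfolding has_subproduct_in_def
        using xs i finprod[of "{i}" xs] by (intro exI[of _ "{i}"]) auto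
    next
      case False
      obtain k l where kl: "k < l" "l \<le> n" "[(\<Sum>i\<in>{k..<l}. ind (xs ! i)) = 0] (mod int n)"
        using zero_sum_block[OF n_pos] by blast
      have elems: "xs ! i \<in> R \<and> \<not> rdvd (of_nat p) (xs ! i)" if "i \<in> {k..<l}" for i
        using that kl xs False by (auto simp: subset_iff)
      have "\<not> rdvd (of_nat p) (\<Prod>i\<in>{k..<l}. xs ! i) \<and> [ind (\<Prod>i\<in>{k..<l}. xs ! i) = (\<Sum>i\<in>{k..<l}. ind (xs ! i))] (mod int n)"
        by (rule ind_prod) (use elems in auto)
      moreover have "(\<Prod>i\<in>{k..<l}. xs ! i) \<in> R" using elems by auto
      ultimately have "(\<Prod>i\<in>{k..<l}. xs ! i) \<in> S" using in_S cong_trans kl(3) by blast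
      moreover have sub: "{k..<l} \<subseteq> {..<length xs}" using kl xs by auto
      moreover have "{k..<l} \<noteq> {}" using kl by simp
      ultimately show ?thesis unfolding has_subproduct_in_def
        using finprod[OF sub xs(2)] by (intro exI[of _ "{k..<l}"]) (simp only: simp_thms)
    qed
  qed
  have lower: "n \<le> k" if "k \<in> good" for k
  proof (rule ccontr)
    assume "\<not> n \<le> k"
    hence "k < n" by simp
    obtain q where q: "irr q" "\<not> rdvd (of_nat p) q" "[ind q = 1] (mod int n) \<or> [ind q = -1] (mod int n)"
      using ex_irr_ind_unit by blast
    have qR: "q \<in> R" using q by (auto simp: irr_def)
    \<comment> \<open>All factors are equal, so the index of a subproduct is the number of its
      factors times \<open>ind q\<close>.\<close>
    define xs where "xs = replicate k q"
    have "R_product (ring_on R) xs"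
      using irr_imp_ring_irreducible[OF q(1)] qR by (auto simp: R_product_def xs_def ring_on_simps)
    hence "has_subproduct_in (ring_on R) S xs" using that by (auto simp: good_def xs_def)
    then obtain I where I: "I \<subseteq> {..<k}" "I \<noteq> {}" "(\<Otimes>\<^bsub>ring_on R\<^esub>i\<in>I. xs ! i) \<in> S"
      by (auto simp: has_subproduct_in_def xs_def)
    have fin: "finite I" using I(1) finite_subset by blast
    have "(\<Otimes>\<^bsub>ring_on R\<^esub>i\<in>I. xs ! i) = (\<Prod>i\<in>I. xs ! i)"
      using I qR by (intro finprod) (auto simp: xs_def)
    also have "\<dots> = (\<Prod>i\<in>I. q)" using I(1) by (intro prod.cong refl) (auto simp: xs_def)
    finally have inS: "(\<Prod>i\<in>I. q) \<in> S" using I(3) by simp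
    have *: "\<not> rdvd (of_nat p) (\<Prod>i\<in>I. q) \<and> [ind (\<Prod>i\<in>I. q) = (\<Sum>i\<in>I. ind q)] (mod int n)"
      by (rule ind_prod) (use fin qR q in auto)
    have "(\<Prod>i\<in>I. q) \<in> R" using qR by auto
    hence "[ind (\<Prod>i\<in>I. q) = 0] (mod int n)" using in_S * inS by blast
    hence "[(\<Sum>i\<in>I. ind q) = 0] (mod int n)" using * cong_trans cong_sym by blast
    hence "[int (card I) * ind q = 0] (mod int n)" by simp
    hence "int n dvd int (card I) * ind q" by (simp only: cong_0_iff)
    \<comment> \<open>An index of 1 or -1 is invertible modulo n, so n divides the number of
      factors, which lies between 1 and k < n.\<close>
    moreover have "coprime (int n) (ind q)"
    proof -
      have "coprime (ind q) (int n)" using q(3) cong_imp_coprime[OF cong_sym, of "ind q"] by fastforce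
      thus ?thesis by (simp add: coprime_commute)
    qed
    ultimately have "int n dvd int (card I)" by (simp add: coprime_dvd_mult_left_iff)
    hence "n dvd card I" by (simp only: of_nat_dvd_iff)
    moreover have "card I > 0" using I(2) fin by auto
    ultimately have "n \<le> card I" by (rule dvd_imp_le)
    moreover have "card I \<le> k" using card_mono[of "{..<k}" I] I(1) by simp
    ultimately show False using \<open>k < n\<close> by linarith
  qed
  have "D_const (ring_on R) S = Inf (enat ` good)" by (simp add: D_const_def good_def)
  also have "\<dots> = enat n"
  proof (rule antisym)
    show "Inf (enat ` good) \<le> enat n" using upper by (intro Inf_lower) auto
    show "enat n \<le> Inf (enat ` good)" using lower by (intro Inf_greatest) auto
  qed
  finally show ?thesis unfolding S_def .
qed

theorem theorem3p2:
  fixes d :: int and p :: nat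
  assumes "squarefree d" and "d < -3"
    and "class_number (quad_field d) = 1"
    and "Factorial_Ring.prime p" and "inert p d"
  shows "D_bar (quad_order (of_nat p * omega d)) = enat (p + 1)"
proof -
  have d0: "d < 0" using assms(2) by simp
  define t m :: int where "t = (if d mod 4 = 1 then 1 else 0)" and "m = (if d mod 4 = 1 then - (d div 4) else - d)"
  interpret imag_quad "omega d" t m unfolding t_def m_def by (rule imag_quad_omega[OF d0])
  interpret imag_quad_units "omega d" t m
    by unfold_locales (rule units_quad_order[OF assms(2,1)])
  have "principal_domain (ring_on R)"
    using assms(3) unfolding class_number_def Let_def ring_of_integers_quad_field[OF d0 assms(1)]
    by (rule principal_domain_if_one_class)
  then interpret imag_quad_ufd "omega d" t m by (rule ufd_if_principal_domain)
  have prime_ideal: "primeideal (PIdl\<^bsub>ring_on R\<^esub> (of_nat p)) (ring_on R)"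
    using assms(5) by (simp add: inert_def Let_def)
  obtain ind where "residue_index (omega d) t m p (p + 1) ind"
    by (rule ex_residue_index[OF assms(4) prime_ideal])
  then interpret residue_index "omega d" t m p "p + 1" ind .
  have "p > 0" using prime_gt_0_nat[OF assms(4)] .
  show ?thesis
    unfolding D_bar_def integral_closure_quad_order[OF d0 assms(1) \<open>p > 0\<close>]
    by (rule D_const_suborder)
qed

end
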